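(* Let $H$ be a cocommutative Hopf algebra over a field $\mathbf{k}$. There is a one-to-one correspondence between skeletal $L_\infty$ $H$-pseudoalgebras and triples of the form $(L,M,\theta)$ in which $L$ is a Lie $H$-pseudoalgebra, $M$ is a representation of $L$ and $\theta\in C^3_{\mathrm{Lie}\text{-}H}(L,M)$ is a $3$-cocycle.
   Context: Polylinear maps. $H^{\otimes n}$ is a right $H$-module via $(h_1\otimes\cdots\otimes h_n)h=h_1h_{(1)}\otimes\cdots\otimes h_nh_{(n)}$. For left $H$-modules, $\mathrm{Hom}_{H^{\otimes n}}(L_1\boxtimes\cdots\boxtimes L_n,H^{\otimes n}\otimes_HM)$ is the space of $H^{\otimes n}$-linear maps $L_1\otimes\cdots\otimes L_n\to H^{\otimes n}\otimes_HM$ ($H^{\otimes n}$ acts factorwise on the source, by left multiplication on the target); its elements are called polylinear. Composition: if $\psi(y_1,\dots,y_l)=\sum_i(h_i^1\otimes\cdots\otimes h_i^l)\otimes_He_i$ and $\varphi(x_1,\dots,x_{m-1},e_i,x_{m+1},\dots,x_k)=\sum_j(f^1_{ij}\otimes\cdots\otimes f^k_{ij})\otimes_He_{ij}$, then $\varphi(x_1,\dots,x_{m-1},\psi(y_1,\dots,y_l),x_{m+1},\dots,x_k)=\sum_{i,j}(f^1_{ij}\otimes\cdots\otimes f^{m-1}_{ij}\otimes h_i^1f^m_{ij(1)}\otimes\cdots\otimes h^l_if^m_{ij(l)}\otimes f^{m+1}_{ij}\otimes\cdots\otimes f^k_{ij})\otimes_He_{ij}$. $H$-linear maps are applied to $H^{\otimes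 n}\otimes_HM$ through the second factor. Slot convention: each factor of $H^{\otimes N}$ is attached to one argument; in identities whose terms involve the same elements in different orders, the $H$-factors are permuted so that they appear in one fixed order of the elements (well defined by cocommutativity). Skew-symmetric means: under this convention, exchanging two arguments changes the sign. A Lie $H$-pseudoalgebra is a left $H$-module $L$ with a skew-symmetric polylinear map $[\cdot*\cdot]:L\boxtimes L\to H^{\otimes2}\otimes_HL$ satisfying $[[x*y]*z]=[x*[y*z]]-[y*[x*z]]$. A representation of $L$ is a left $H$-module $M$ with a polylinear map $L\boxtimes M\to H^{\otimes2}\otimes_HM$, $x\otimes u\mapsto x*u$, satisfying $[x*y]*u=x*(y*u)-y*(x*u)$. For $n\ge1$, $C^n_{\mathrm{Lie}\text{-}H}(L,M)$ is the space of skew-symmetric polylinear maps $L^{\boxtimes n}\to H^{\otimes n}\otimes_HM$, with coboundary (slot convention in force) $$(\delta\theta)(x_1,\dots,x_{n+1})=\sum_{i=1}^{n+1}(-1)^{i+1}x_i*\theta(x_1,\dots,\widehat{x_i},\dots,x_{n+1})+\sum_{i<j}(-1)^{i+j}\theta([x_i*x_j],x_1,\dots,\widehat{x_i},\dots,\widehat{x_j},\dots,x_{n+1}).$$ An $n$-cocycle is $\theta$ with $\delta\theta=0$. A $2$-term $L_\infty$ $H$-pseudoalgebra $(\mathcal{L}_1\xrightarrow{\beta_1}\mathcal{L}_0,\beta_2,\beta_3)$: left $H$-modules $\mathcal{L}_0,\mathcal{L}_1$, an $H$-linear map $\beta_1$, a skew-symmetric polylinear $\beta_2$ with components $\mathcal{L}_i\boxtimes\mathcal{L}_j\to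 H^{\otimes2}\otimes_H\mathcal{L}_{i+j}$ (zero on $\mathcal{L}_1\boxtimes\mathcal{L}_1$; $\beta_2(u,x)=-\beta_2(x,u)$ under the slot convention), and a skew-symmetric polylinear $\beta_3:\mathcal{L}_0^{\boxtimes3}\to H^{\otimes3}\otimes_H\mathcal{L}_1$, such that for $x,y,z,w\in\mathcal{L}_0$, $u,v\in\mathcal{L}_1$: (i) $\beta_1(\beta_2(x,u))=\beta_2(x,\beta_1(u))$; (ii) $\beta_2(\beta_1(u),v)=\beta_2(u,\beta_1(v))$; (iii) $\beta_2(\beta_2(x,y),z)-\beta_2(x,\beta_2(y,z))+\beta_2(y,\beta_2(x,z))=-\beta_1(\beta_3(x,y,z))$; (iv) $\beta_2(\beta_2(x,y),v)-\beta_2(x,\beta_2(y,v))+\beta_2(y,\beta_2(x,v))=-\beta_3(x,y,\beta_1(v))$; (v) $\beta_2(x,\beta_3(y,z,w))-\beta_2(y,\beta_3(x,z,w))+\beta_2(z,\beta_3(x,y,w))-\beta_2(w,\beta_3(x,y,z))-\beta_3(\beta_2(x,y),z,w)+\beta_3(\beta_2(x,z),y,w)-\beta_3(\beta_2(x,w),y,z)-\beta_3(\beta_2(y,z),x,w)+\beta_3(\beta_2(y,w),x,z)-\beta_3(\beta_2(z,w),x,y)=0$. It is called a skeletal $L_\infty$ $H$-pseudoalgebra if $\beta_1=0$. *)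

theory Defs
  imports "HOL-Algebra.Algebra"
begin

section \<open>Presented abelian groups\<close>

text \<open>
  All tensor products below are quotients of free abelian groups, written additively.  Only the
  additive part of the ring record is meaningful.
\<close>

definition presented :: "'a set \<Rightarrow> ('a \<Rightarrow>\<^sub>0 int) set \<Rightarrow> ('a \<Rightarrow>\<^sub>0 int) set ring" where
  "presented S R =
    (let Q = free_Abelian_group S Mod generate (free_Abelian_group S) R
     in \<lparr>carrier = carrier Q, monoid.mult = undefined, one = undefined,
         ring.zero = \<one>\<^bsub>Q\<^esub>, ring.add = monoid.mult Q\<rparr>)"

definition presented_class :: "'a set \<Rightarrow> ('a \<Rightarrow>\<^sub>0 int) set \<Rightarrow> 'a \<Rightarrow> ('a \<Rightarrow>\<^sub>0 int) set" where
  "presented_class S R x =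
    generate (free_Abelian_group S) R #>\<^bsub>free_Abelian_group S\<^esub> frag_of x"

definition list_sum :: "('a, 'b) ring_scheme \<Rightarrow> 'a list \<Rightarrow> 'a" where
  "list_sum G xs = foldr (ring.add G) xs \<zero>\<^bsub>G\<^esub>"

text \<open>Left modules over a ring that need not be commutative.\<close>

locale left_module = R?: ring R + M?: abelian_group M
  for R :: "('a, 'r) ring_scheme" (structure) and M :: "('a, 'b, 'm) module_scheme" (structure) +
  assumes smult_closed:
      "\<lbrakk>a \<in> carrier R; x \<in> carrier M\<rbrakk> \<Longrightarrow> a \<odot>\<^bsub>M\<^esub> x \<in> carrier M"
    and smult_l_distr:
      "\<lbrakk>a \<in> carrier R; b \<in> carrier R; x \<in> carrier M\<rbrakk> \<Longrightarrow>
        (a \<oplus>\<^bsub>R\<^esub> b) \<odot>\<^bsub>M\<^esub> x = a \<odot>\<^bsub>M\<^esub> x \<oplus>\<^bsub>M\<^esub> b \<odot>\<^bsub>M\<^esub> x"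
    and smult_r_distr:
      "\<lbrakk>a \<in> carrier R; x \<in> carrier M; y \<in> carrier M\<rbrakk> \<Longrightarrow>
        a \<odot>\<^bsub>M\<^esub> (x \<oplus>\<^bsub>M\<^esub> y) = a \<odot>\<^bsub>M\<^esub> x \<oplus>\<^bsub>M\<^esub> a \<odot>\<^bsub>M\<^esub> y"
    and smult_assoc1:
      "\<lbrakk>a \<in> carrier R; b \<in> carrier R; x \<in> carrier M\<rbrakk> \<Longrightarrow>
        (a \<otimes>\<^bsub>R\<^esub> b) \<odot>\<^bsub>M\<^esub> x = a \<odot>\<^bsub>M\<^esub> (b \<odot>\<^bsub>M\<^esub> x)"
    and smult_one:
      "x \<in> carrier M \<Longrightarrow> \<one>\<^bsub>R\<^esub> \<odot>\<^bsub>M\<^esub> x = x"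


section \<open>Tensor powers of a Hopf algebra\<close>

text \<open>
  An element of the tensor power is a coset of formal sums of words \<open>[h\<^sub>1, \<dots>, h\<^sub>n]\<close>,
  an element of \<open>H\<^sup>\<otimes>\<^sup>n \<otimes>\<^sub>H M\<close> a coset of formal sums of pairs.
\<close>

type_synonym 'h tpow = "('h list \<Rightarrow>\<^sub>0 int) set"
type_synonym ('h, 'm) htens = "('h tpow \<times> 'm \<Rightarrow>\<^sub>0 int) set"

record ('k, 'h) hopf = "('k, 'h) module" +
  comult :: "'h \<Rightarrow> 'h tpow"
  counit :: "'h \<Rightarrow> 'k"
  antipode :: "'h \<Rightarrow> 'h"

text \<open>The axioms for \<open>K\<close> and \<open>H\<close> are added further down, in the locale
  \<open>cocommutative_hopf_algebra\<close>, since they already refer to tensor powers.\<close>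

locale hopf_signature =
  fixes K :: "('k, 'r) ring_scheme" and H :: "('k, 'h) hopf"
begin

definition words :: "nat \<Rightarrow> 'h list set" where
  "words n = {hs. length hs = n \<and> set hs \<subseteq> carrier H}"

definition tpow_rels :: "nat \<Rightarrow> ('h list \<Rightarrow>\<^sub>0 int) set" where
  "tpow_rels n =
    {frag_of (hs[i := a \<oplus>\<^bsub>H\<^esub> b]) - frag_of (hs[i := a]) - frag_of (hs[i := b]) |hs i a b.
        hs \<in> words n \<and> i < n \<and> a \<in> carrier H \<and> b \<in> carrier H} \<union>
    {frag_of (hs[i := c \<odot>\<^bsub>H\<^esub> (hs ! i)]) - frag_of (hs[j := c \<odot>\<^bsub>H\<^esub> (hs ! j)]) |hs i j c.
        hs \<in> words n \<and> i < n \<and> j < n \<and> c \<in> carrier K}"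

definition tpow_add :: "nat \<Rightarrow> 'h tpow ring" where
  "tpow_add n = presented (words n) (tpow_rels n)"

definition tens :: "'h list \<Rightarrow> 'h tpow" where
  "tens hs = presented_class (words (length hs)) (tpow_rels (length hs)) hs"

definition tpow_rep :: "nat \<Rightarrow> 'h tpow \<Rightarrow> 'h list list \<Rightarrow> bool" where
  "tpow_rep n T ps \<longleftrightarrow> set ps \<subseteq> words n \<and> T = list_sum (tpow_add n) (map tens ps)"

text \<open>
  \<open>tpow_ext n G f T = \<Sum>\<^sub>i f hs\<^sub>i\<close> for a chosen expression
  \<open>T = \<Sum>\<^sub>i tens hs\<^sub>i\<close>, \<open>n \<ge> 1\<close> (signs can be absorbed into a factor).  It is used
  for \<open>K\<close>-multilinear \<open>f\<close> only, so that the value does not depend on the choice.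
\<close>

definition tpow_ext :: "nat \<Rightarrow> ('b, 'c) ring_scheme \<Rightarrow> ('h list \<Rightarrow> 'b) \<Rightarrow> 'h tpow \<Rightarrow> 'b" where
  "tpow_ext n G f T = list_sum G (map f (SOME ps. tpow_rep n T ps))"

text \<open>The \<open>K\<close>-algebra \<open>H\<^sup>\<otimes>\<^sup>n\<close>, for \<open>n \<ge> 1\<close>.\<close>

definition tensor_power :: "nat \<Rightarrow> ('k, 'h tpow) module" where
  "tensor_power n =
    \<lparr>carrier = carrier (tpow_add n),
     monoid.mult = (\<lambda>T U. tpow_ext n (tpow_add n)
        (\<lambda>hs. tpow_ext n (tpow_add n) (\<lambda>gs. tens (map2 (monoid.mult H) hs gs)) U) T),
     one = tens (replicate n \<one>\<^bsub>H\<^esub>),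
     ring.zero = \<zero>\<^bsub>tpow_add n\<^esub>,
     ring.add = ring.add (tpow_add n),
     smult = (\<lambda>c. tpow_ext n (tpow_add n) (\<lambda>hs. tens (hs[0 := c \<odot>\<^bsub>H\<^esub> (hs ! 0)])))\<rparr>"

definition comult_at :: "nat \<Rightarrow> nat \<Rightarrow> 'h tpow \<Rightarrow> 'h tpow" where
  "comult_at n i = tpow_ext n (tensor_power (Suc n))
    (\<lambda>hs. tpow_ext 2 (tensor_power (Suc n))
      (\<lambda>gs. tens (take i hs @ gs @ drop (Suc i) hs)) (comult H (hs ! i)))"

text \<open>\<open>iter_comult n h = h\<^sub>(\<^sub>1\<^sub>) \<otimes> \<cdots> \<otimes> h\<^sub>(\<^sub>n\<^sub>+\<^sub>1\<^sub>)\<close>,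
  an element of the tensor power with exponent \<open>n + 1\<close>.\<close>

primrec iter_comult :: "nat \<Rightarrow> 'h \<Rightarrow> 'h tpow" where
  "iter_comult 0 h = tens [h]"
| "iter_comult (Suc n) h = comult_at (Suc n) 0 (iter_comult n h)"

end

locale cocommutative_hopf_algebra = hopf_signature K H + K?: field K + H?: ring H
  for K :: "('k, 'r) ring_scheme" and H :: "('k, 'h) hopf" +
  assumes vector_space: "module K H"
    and smult_mult_left:
      "\<lbrakk>c \<in> carrier K; g \<in> carrier H; h \<in> carrier H\<rbrakk> \<Longrightarrow>
        (c \<odot>\<^bsub>H\<^esub> g) \<otimes>\<^bsub>H\<^esub> h = c \<odot>\<^bsub>H\<^esub> (g \<otimes>\<^bsub>H\<^esub> h)"
    and smult_mult_right:
      "\<lbrakk>c \<in> carrier K; g \<in> carrier H; h \<in> carrier H\<rbrakk> \<Longrightarrow>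
        g \<otimes>\<^bsub>H\<^esub> (c \<odot>\<^bsub>H\<^esub> h) = c \<odot>\<^bsub>H\<^esub> (g \<otimes>\<^bsub>H\<^esub> h)"
    and comult_hom: "comult H \<in> ring_hom H (tensor_power 2)"
    and comult_smult:
      "\<lbrakk>c \<in> carrier K; h \<in> carrier H\<rbrakk> \<Longrightarrow>
        comult H (c \<odot>\<^bsub>H\<^esub> h) = c \<odot>\<^bsub>tensor_power 2\<^esub> comult H h"
    and counit_hom: "counit H \<in> ring_hom H K"
    and counit_smult:
      "\<lbrakk>c \<in> carrier K; h \<in> carrier H\<rbrakk> \<Longrightarrow>
        counit H (c \<odot>\<^bsub>H\<^esub> h) = c \<otimes>\<^bsub>K\<^esub> counit H h"
    and antipode_closed: "h \<in> carrier H \<Longrightarrow> antipode H h \<in> carrier H"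
    and antipode_add:
      "\<lbrakk>g \<in> carrier H; h \<in> carrier H\<rbrakk> \<Longrightarrow>
        antipode H (g \<oplus>\<^bsub>H\<^esub> h) = antipode H g \<oplus>\<^bsub>H\<^esub> antipode H h"
    and antipode_smult:
      "\<lbrakk>c \<in> carrier K; h \<in> carrier H\<rbrakk> \<Longrightarrow>
        antipode H (c \<odot>\<^bsub>H\<^esub> h) = c \<odot>\<^bsub>H\<^esub> antipode H h"
    and coassociative:
      "h \<in> carrier H \<Longrightarrow> comult_at 2 0 (comult H h) = comult_at 2 1 (comult H h)"
    and counit_left:
      "h \<in> carrier H \<Longrightarrow>
        tpow_ext 2 H (\<lambda>hs. counit H (hs ! 0) \<odot>\<^bsub>H\<^esub> (hs ! 1)) (comult H h) = h"
    and counit_right: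
      "h \<in> carrier H \<Longrightarrow>
        tpow_ext 2 H (\<lambda>hs. counit H (hs ! 1) \<odot>\<^bsub>H\<^esub> (hs ! 0)) (comult H h) = h"
    and antipode_left:
      "h \<in> carrier H \<Longrightarrow>
        tpow_ext 2 H (\<lambda>hs. antipode H (hs ! 0) \<otimes>\<^bsub>H\<^esub> (hs ! 1)) (comult H h)
          = counit H h \<odot>\<^bsub>H\<^esub> \<one>\<^bsub>H\<^esub>"
    and antipode_right:
      "h \<in> carrier H \<Longrightarrow>
        tpow_ext 2 H (\<lambda>hs. (hs ! 0) \<otimes>\<^bsub>H\<^esub> antipode H (hs ! 1)) (comult H h)
          = counit H h \<odot>\<^bsub>H\<^esub> \<one>\<^bsub>H\<^esub>"
    and cocommutative:
      "h \<in> carrier H \<Longrightarrow>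
        tpow_ext 2 (tensor_power 2) (\<lambda>hs. tens [hs ! 1, hs ! 0]) (comult H h) = comult H h"


section \<open>The modules \<open>H\<^sup>\<otimes>\<^sup>n \<otimes>\<^sub>H M\<close>\<close>

context hopf_signature
begin

text \<open>\<open>(h\<^sub>1 \<otimes> \<cdots> \<otimes> h\<^sub>n) h = h\<^sub>1 h\<^sub>(\<^sub>1\<^sub>) \<otimes> \<cdots> \<otimes> h\<^sub>n h\<^sub>(\<^sub>n\<^sub>)\<close>\<close>

definition right_act :: "nat \<Rightarrow> 'h tpow \<Rightarrow> 'h \<Rightarrow> 'h tpow" where
  "right_act n T h = T \<otimes>\<^bsub>tensor_power n\<^esub> iter_comult (n - 1) h"

definition htensor_gens :: "nat \<Rightarrow> ('h, 'm) module \<Rightarrow> ('h tpow \<times> 'm) set" where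
  "htensor_gens n M = carrier (tensor_power n) \<times> carrier M"

definition htensor_rels :: "nat \<Rightarrow> ('h, 'm) module \<Rightarrow> ('h tpow \<times> 'm \<Rightarrow>\<^sub>0 int) set" where
  "htensor_rels n M =
    {frag_of (T \<oplus>\<^bsub>tensor_power n\<^esub> U, x) - frag_of (T, x) - frag_of (U, x) |T U x.
        T \<in> carrier (tensor_power n) \<and> U \<in> carrier (tensor_power n) \<and> x \<in> carrier M} \<union>
    {frag_of (T, x \<oplus>\<^bsub>M\<^esub> y) - frag_of (T, x) - frag_of (T, y) |T x y.
        T \<in> carrier (tensor_power n) \<and> x \<in> carrier M \<and> y \<in> carrier M} \<union>
    {frag_of (right_act n T h, x) - frag_of (T, h \<odot>\<^bsub>M\<^esub> x) |T h x.
        T \<in> carrier (tensor_power n) \<and> h \<in> carrier H \<and> x \<in> carrier M}"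

definition htensor_add :: "nat \<Rightarrow> ('h, 'm) module \<Rightarrow> ('h, 'm) htens ring" where
  "htensor_add n M = presented (htensor_gens n M) (htensor_rels n M)"

definition htensor_class :: "nat \<Rightarrow> ('h, 'm) module \<Rightarrow> 'h tpow \<Rightarrow> 'm \<Rightarrow> ('h, 'm) htens" where
  "htensor_class n M T x = presented_class (htensor_gens n M) (htensor_rels n M) (T, x)"

text \<open>\<open>pure M [h\<^sub>1, \<dots>, h\<^sub>n] x = (h\<^sub>1 \<otimes> \<cdots> \<otimes> h\<^sub>n) \<otimes>\<^sub>H x\<close>\<close>

definition pure :: "('h, 'm) module \<Rightarrow> 'h list \<Rightarrow> 'm \<Rightarrow> ('h, 'm) htens" where
  "pure M hs x = htensor_class (length hs) M (tens hs) x"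

definition htensor_rep :: "nat \<Rightarrow> ('h, 'm) module \<Rightarrow> ('h, 'm) htens \<Rightarrow> ('h list \<times> 'm) list \<Rightarrow> bool"
  where "htensor_rep n M w ps \<longleftrightarrow>
    set ps \<subseteq> words n \<times> carrier M \<and> w = list_sum (htensor_add n M) (map (\<lambda>(hs, x). pure M hs x) ps)"

text \<open>
  \<open>htensor_ext n M G f w = \<Sum>\<^sub>i f hs\<^sub>i x\<^sub>i\<close> for a chosen expression
  \<open>w = \<Sum>\<^sub>i pure M hs\<^sub>i x\<^sub>i\<close>, \<open>n \<ge> 1\<close>.  It is used for \<open>f\<close> that factor
  through \<open>H\<^sup>\<otimes>\<^sup>n \<otimes>\<^sub>H M\<close> only, so that the value does not depend on the choice.
\<close>

definition htensor_ext ::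
  "nat \<Rightarrow> ('h, 'm) module \<Rightarrow> ('b, 'c) ring_scheme \<Rightarrow> ('h list \<Rightarrow> 'm \<Rightarrow> 'b) \<Rightarrow> ('h, 'm) htens \<Rightarrow> 'b"
  where "htensor_ext n M G f w =
    list_sum G (map (\<lambda>(hs, x). f hs x) (SOME ps. htensor_rep n M w ps))"

text \<open>The left \<open>H\<^sup>\<otimes>\<^sup>n\<close>-module \<open>H\<^sup>\<otimes>\<^sup>n \<otimes>\<^sub>H M\<close>, for \<open>n \<ge> 1\<close>.\<close>

definition htensor :: "nat \<Rightarrow> ('h, 'm) module \<Rightarrow> ('h tpow, ('h, 'm) htens) module" where
  "htensor n M =
    \<lparr>carrier = carrier (htensor_add n M), monoid.mult = undefined, one = undefined,
     ring.zero = \<zero>\<^bsub>htensor_add n M\<^esub>, ring.add = ring.add (htensor_add n M),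
     smult = (\<lambda>T. htensor_ext n M (htensor_add n M)
       (\<lambda>hs x. htensor_class n M (T \<otimes>\<^bsub>tensor_power n\<^esub> tens hs) x))\<rparr>"

text \<open>The map induced on \<open>H\<^sup>\<otimes>\<^sup>n \<otimes>\<^sub>H A\<close> by an \<open>H\<close>-linear map
  \<open>b\<close> from \<open>A\<close> to \<open>B\<close>.\<close>

definition push ::
  "nat \<Rightarrow> ('h, 'a) module \<Rightarrow> ('h, 'b) module \<Rightarrow> ('a \<Rightarrow> 'b) \<Rightarrow> ('h, 'a) htens \<Rightarrow> ('h, 'b) htens" where
  "push n A B b = htensor_ext n A (htensor n B) (\<lambda>hs x. pure B hs (b x))"

text \<open>
  The slot convention: the arguments of a term are numbered from 0 in the fixed order, \<open>s\<close>
  lists these numbers in the order in which the arguments occur in the term, and the factors of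
  \<open>H\<close>, which come in the order of occurrence, are moved to the fixed order.
\<close>

definition slots :: "('h, 'm) module \<Rightarrow> nat list \<Rightarrow> ('h, 'm) htens \<Rightarrow> ('h, 'm) htens" where
  "slots M s = htensor_ext (length s) M (htensor (length s) M)
    (\<lambda>hs x. pure M (map snd (sort_key fst (zip s hs))) x)"

text \<open>
  The composite of a \<open>k\<close>-ary map into \<open>B\<close> with an inner value
  \<open>w = \<Sum>\<^sub>i (h\<^sub>i\<^sup>1 \<otimes> \<cdots> \<otimes> h\<^sub>i\<^sup>l) \<otimes>\<^sub>H e\<^sub>i\<close> over \<open>A\<close> put into argument \<open>m\<close>
  (counted from 0).  The other arguments of the outer map are held fixed, so it enters as a
  function \<open>\<Phi>\<close> of this argument alone.
\<close>

definition insert_at ::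
  "('h, 'b) module \<Rightarrow> nat \<Rightarrow> nat \<Rightarrow> ('a \<Rightarrow> ('h, 'b) htens) \<Rightarrow>
    ('h, 'a) module \<Rightarrow> nat \<Rightarrow> ('h, 'a) htens \<Rightarrow> ('h, 'b) htens" where
  "insert_at B k m \<Phi> A l w =
    (let Q = htensor (k + l - 1) B in
      htensor_ext l A Q (\<lambda>hs e.
        htensor_ext k B Q (\<lambda>fs e'.
          tpow_ext l Q (\<lambda>gs.
            pure B (take m fs @ map2 (monoid.mult H) hs gs @ drop (Suc m) fs) e')
          (iter_comult (l - 1) (fs ! m)))
        (\<Phi> e)) w)"

text \<open>\<open>\<phi>(w, z)\<close> and \<open>\<phi>(x, w)\<close> for binary \<open>\<phi>\<close> into \<open>B\<close>.\<close>

definition ins_left ::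
  "('h, 'b) module \<Rightarrow> ('a \<times> 'c \<Rightarrow> ('h, 'b) htens) \<Rightarrow>
    ('h, 'a) module \<Rightarrow> nat \<Rightarrow> ('h, 'a) htens \<Rightarrow> 'c \<Rightarrow> ('h, 'b) htens" where
  "ins_left B \<phi> A l w z = insert_at B 2 0 (\<lambda>e. \<phi> (e, z)) A l w"

definition ins_right ::
  "('h, 'b) module \<Rightarrow> ('c \<times> 'a \<Rightarrow> ('h, 'b) htens) \<Rightarrow>
    'c \<Rightarrow> ('h, 'a) module \<Rightarrow> nat \<Rightarrow> ('h, 'a) htens \<Rightarrow> ('h, 'b) htens" where
  "ins_right B \<phi> x A l w = insert_at B 2 1 (\<lambda>e. \<phi> (x, e)) A l w"


section \<open>Polylinear maps\<close>

text \<open>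
  A map out of \<open>L\<^sub>1 \<otimes> \<cdots> \<otimes> L\<^sub>n\<close> is given as a multiadditive map of \<open>n\<close> arguments, and
  its \<open>H\<^sup>\<otimes>\<^sup>n\<close>-linearity is stated for the spanning elements \<open>h\<^sub>1 \<otimes> \<cdots> \<otimes> h\<^sub>n\<close>;
  this includes multilinearity over \<open>K\<close>, whose action on a module is that of
  \<open>c \<odot>\<^bsub>H\<^esub> \<one>\<^bsub>H\<^esub>\<close>.  Maps are \<open>undefined\<close> outside the carriers.
\<close>

definition polylinear2 ::
  "('h, 'a) module \<Rightarrow> ('h, 'b) module \<Rightarrow> ('h, 'c) module \<Rightarrow> ('a \<times> 'b \<Rightarrow> ('h, 'c) htens) set" where
  "polylinear2 A B C =
    {\<phi> \<in> carrier A \<times> carrier B \<rightarrow>\<^sub>E carrier (htensor 2 C).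
      (\<forall>x\<in>carrier A. \<forall>x'\<in>carrier A. \<forall>y\<in>carrier B.
        \<phi> (x \<oplus>\<^bsub>A\<^esub> x', y) = \<phi> (x, y) \<oplus>\<^bsub>htensor 2 C\<^esub> \<phi> (x', y)) \<and>
      (\<forall>x\<in>carrier A. \<forall>y\<in>carrier B. \<forall>y'\<in>carrier B.
        \<phi> (x, y \<oplus>\<^bsub>B\<^esub> y') = \<phi> (x, y) \<oplus>\<^bsub>htensor 2 C\<^esub> \<phi> (x, y')) \<and>
      (\<forall>g\<in>carrier H. \<forall>h\<in>carrier H. \<forall>x\<in>carrier A. \<forall>y\<in>carrier B.
        \<phi> (g \<odot>\<^bsub>A\<^esub> x, h \<odot>\<^bsub>B\<^esub> y) = tens [g, h] \<odot>\<^bsub>htensor 2 C\<^esub> \<phi> (x, y))}"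

definition arguments :: "nat \<Rightarrow> ('h, 'l) module \<Rightarrow> 'l list set" where
  "arguments n L = {xs. length xs = n \<and> set xs \<subseteq> carrier L}"

definition polylinear ::
  "nat \<Rightarrow> ('h, 'l) module \<Rightarrow> ('h, 'm) module \<Rightarrow> ('l list \<Rightarrow> ('h, 'm) htens) set" where
  "polylinear n L M =
    {\<phi> \<in> arguments n L \<rightarrow>\<^sub>E carrier (htensor n M).
      (\<forall>xs\<in>arguments n L. \<forall>i<n. \<forall>x\<in>carrier L. \<forall>y\<in>carrier L.
        \<phi> (xs[i := x \<oplus>\<^bsub>L\<^esub> y]) = \<phi> (xs[i := x]) \<oplus>\<^bsub>htensor n M\<^esub> \<phi> (xs[i := y])) \<and>
      (\<forall>hs\<in>words n. \<forall>xs\<in>arguments n L.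
        \<phi> (map2 (smult L) hs xs) = tens hs \<odot>\<^bsub>htensor n M\<^esub> \<phi> xs)}"

definition swap :: "nat \<Rightarrow> nat \<Rightarrow> 'a list \<Rightarrow> 'a list" where
  "swap i j xs = xs[i := xs ! j, j := xs ! i]"

text \<open>The space \<open>C\<^sup>n(L, M)\<close>, for \<open>n \<ge> 1\<close>.\<close>

definition cochains ::
  "nat \<Rightarrow> ('h, 'l) module \<Rightarrow> ('h, 'm) module \<Rightarrow> ('l list \<Rightarrow> ('h, 'm) htens) set" where
  "cochains n L M =
    {\<theta> \<in> polylinear n L M.
      \<forall>xs\<in>arguments n L. \<forall>i<n. \<forall>j<n. i \<noteq> j \<longrightarrow>
        slots M (swap i j [0..<n]) (\<theta> (swap i j xs)) = \<ominus>\<^bsub>htensor n M\<^esub> \<theta> xs}"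


section \<open>Lie pseudoalgebras, representations and cohomology\<close>

definition lie_pseudoalgebra :: "('h, 'l) module \<Rightarrow> ('l \<times> 'l \<Rightarrow> ('h, 'l) htens) \<Rightarrow> bool" where
  "lie_pseudoalgebra L br \<longleftrightarrow>
    left_module H L \<and>
    br \<in> polylinear2 L L L \<and>
    (\<forall>x\<in>carrier L. \<forall>y\<in>carrier L.
      slots L [1, 0] (br (y, x)) = \<ominus>\<^bsub>htensor 2 L\<^esub> br (x, y)) \<and>
    (\<forall>x\<in>carrier L. \<forall>y\<in>carrier L. \<forall>z\<in>carrier L.
      ins_left L br L 2 (br (x, y)) z =
        ins_right L br x L 2 (br (y, z))
          \<ominus>\<^bsub>htensor 3 L\<^esub> slots L [1, 0, 2] (ins_right L br y L 2 (br (x, z))))"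

definition representation ::
  "('h, 'l) module \<Rightarrow> ('l \<times> 'l \<Rightarrow> ('h, 'l) htens) \<Rightarrow>
    ('h, 'm) module \<Rightarrow> ('l \<times> 'm \<Rightarrow> ('h, 'm) htens) \<Rightarrow> bool" where
  "representation L br M act \<longleftrightarrow>
    left_module H M \<and>
    act \<in> polylinear2 L M M \<and>
    (\<forall>x\<in>carrier L. \<forall>y\<in>carrier L. \<forall>u\<in>carrier M.
      ins_left M act L 2 (br (x, y)) u =
        ins_right M act x M 2 (act (y, u))
          \<ominus>\<^bsub>htensor 3 M\<^esub> slots M [1, 0, 2] (ins_right M act y M 2 (act (x, u))))"

text \<open>
  Arguments are counted from 0, so that \<open>(-1)\<^sup>i\<^sup>+\<^sup>1\<close> becomes \<open>(-1)\<^sup>i\<close>, while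
  \<open>(-1)\<^sup>i\<^sup>+\<^sup>j\<close> is unchanged.
\<close>

definition signed :: "('b, 'c) ring_scheme \<Rightarrow> nat \<Rightarrow> 'b \<Rightarrow> 'b" where
  "signed G i v = (if even i then v else \<ominus>\<^bsub>G\<^esub> v)"

definition coboundary ::
  "('h, 'l) module \<Rightarrow> ('l \<times> 'l \<Rightarrow> ('h, 'l) htens) \<Rightarrow>
    ('h, 'm) module \<Rightarrow> ('l \<times> 'm \<Rightarrow> ('h, 'm) htens) \<Rightarrow>
    nat \<Rightarrow> ('l list \<Rightarrow> ('h, 'm) htens) \<Rightarrow> 'l list \<Rightarrow> ('h, 'm) htens" where
  "coboundary L br M act n \<theta> xs =
    (let Q = htensor (Suc n) M in
      (\<Oplus>\<^bsub>Q\<^esub>i\<in>{..n}.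
        signed Q i
          (slots M (i # nths [0..<Suc n] (- {i}))
            (ins_right M act (xs ! i) M n (\<theta> (nths xs (- {i}))))))
      \<oplus>\<^bsub>Q\<^esub>
      (\<Oplus>\<^bsub>Q\<^esub>j\<in>{..n}. \<Oplus>\<^bsub>Q\<^esub>i\<in>{..<j}.
        signed Q (i + j)
          (slots M (i # j # nths [0..<Suc n] (- {i, j}))
            (insert_at M n 0 (\<lambda>e. \<theta> (e # nths xs (- {i, j}))) L 2 (br (xs ! i, xs ! j))))))"

definition cocycle ::
  "('h, 'l) module \<Rightarrow> ('l \<times> 'l \<Rightarrow> ('h, 'l) htens) \<Rightarrow>
    ('h, 'm) module \<Rightarrow> ('l \<times> 'm \<Rightarrow> ('h, 'm) htens) \<Rightarrow>
    nat \<Rightarrow> ('l list \<Rightarrow> ('h, 'm) htens) \<Rightarrow> bool" where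
  "cocycle L br M act n \<theta> \<longleftrightarrow>
    \<theta> \<in> cochains n L M \<and>
    (\<forall>xs\<in>arguments (Suc n) L. coboundary L br M act n \<theta> xs = \<zero>\<^bsub>htensor (Suc n) M\<^esub>)"

end


section \<open>2-term \<open>L\<^sub>\<infinity>\<close> pseudoalgebras\<close>

text \<open>
  \<open>beta2_ij\<close> is the component of \<open>\<beta>\<^sub>2\<close> on \<open>\<L>\<^sub>i\<close> and \<open>\<L>\<^sub>j\<close>; the component on two
  copies of \<open>\<L>\<^sub>1\<close> is zero and not recorded.
\<close>

record ('h, 'l, 'm) two_term =
  L0 :: "('h, 'l) module"
  L1 :: "('h, 'm) module"
  beta1 :: "'m \<Rightarrow> 'l"
  beta2_00 :: "'l \<times> 'l \<Rightarrow> ('h, 'l) htens"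
  beta2_01 :: "'l \<times> 'm \<Rightarrow> ('h, 'm) htens"
  beta2_10 :: "'m \<times> 'l \<Rightarrow> ('h, 'm) htens"
  beta3 :: "'l list \<Rightarrow> ('h, 'm) htens"

context hopf_signature
begin

definition linear_maps :: "('h, 'a) module \<Rightarrow> ('h, 'b) module \<Rightarrow> ('a \<Rightarrow> 'b) set" where
  "linear_maps A B =
    {f \<in> carrier A \<rightarrow>\<^sub>E carrier B.
      (\<forall>x\<in>carrier A. \<forall>y\<in>carrier A. f (x \<oplus>\<^bsub>A\<^esub> y) = f x \<oplus>\<^bsub>B\<^esub> f y) \<and>
      (\<forall>h\<in>carrier H. \<forall>x\<in>carrier A. f (h \<odot>\<^bsub>A\<^esub> x) = h \<odot>\<^bsub>B\<^esub> f x)}"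

definition L_infinity :: "('h, 'l, 'm) two_term \<Rightarrow> bool" where
  "L_infinity V \<longleftrightarrow>
    (let A = L0 V; B = L1 V; b1 = beta1 V;
         b00 = beta2_00 V; b01 = beta2_01 V; b10 = beta2_10 V; b3 = beta3 V;
         T3A = htensor 3 A; T3B = htensor 3 B; T4B = htensor 4 B
     in
      left_module H A \<and> left_module H B \<and>
      b1 \<in> linear_maps B A \<and>
      b00 \<in> polylinear2 A A A \<and> b01 \<in> polylinear2 A B B \<and> b10 \<in> polylinear2 B A B \<and>
      (\<forall>x\<in>carrier A. \<forall>y\<in>carrier A.
        slots A [1, 0] (b00 (y, x)) = \<ominus>\<^bsub>htensor 2 A\<^esub> b00 (x, y)) \<and>
      (\<forall>x\<in>carrier A. \<forall>u\<in>carrier B.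
        b10 (u, x) = \<ominus>\<^bsub>htensor 2 B\<^esub> slots B [1, 0] (b01 (x, u))) \<and>
      b3 \<in> cochains 3 A B \<and>
      (\<forall>x\<in>carrier A. \<forall>u\<in>carrier B.
        push 2 B A b1 (b01 (x, u)) = b00 (x, b1 u)) \<and>
      (\<forall>u\<in>carrier B. \<forall>v\<in>carrier B.
        b01 (b1 u, v) = b10 (u, b1 v)) \<and>
      (\<forall>x\<in>carrier A. \<forall>y\<in>carrier A. \<forall>z\<in>carrier A.
        ins_left A b00 A 2 (b00 (x, y)) z
          \<ominus>\<^bsub>T3A\<^esub> ins_right A b00 x A 2 (b00 (y, z))
          \<oplus>\<^bsub>T3A\<^esub> slots A [1, 0, 2] (ins_right A b00 y A 2 (b00 (x, z)))
        = \<ominus>\<^bsub>T3A\<^esub> push 3 B A b1 (b3 [x, y, z])) \<and>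
      (\<forall>x\<in>carrier A. \<forall>y\<in>carrier A. \<forall>v\<in>carrier B.
        ins_left B b01 A 2 (b00 (x, y)) v
          \<ominus>\<^bsub>T3B\<^esub> ins_right B b01 x B 2 (b01 (y, v))
          \<oplus>\<^bsub>T3B\<^esub> slots B [1, 0, 2] (ins_right B b01 y B 2 (b01 (x, v)))
        = \<ominus>\<^bsub>T3B\<^esub> b3 [x, y, b1 v]) \<and>
      (\<forall>x\<in>carrier A. \<forall>y\<in>carrier A. \<forall>z\<in>carrier A. \<forall>w\<in>carrier A.
        ins_right B b01 x B 3 (b3 [y, z, w])
          \<ominus>\<^bsub>T4B\<^esub> slots B [1, 0, 2, 3] (ins_right B b01 y B 3 (b3 [x, z, w]))
          \<oplus>\<^bsub>T4B\<^esub> slots B [2, 0, 1, 3] (ins_right B b01 z B 3 (b3 [x, y, w]))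
          \<ominus>\<^bsub>T4B\<^esub> slots B [3, 0, 1, 2] (ins_right B b01 w B 3 (b3 [x, y, z]))
          \<ominus>\<^bsub>T4B\<^esub> insert_at B 3 0 (\<lambda>e. b3 [e, z, w]) A 2 (b00 (x, y))
          \<oplus>\<^bsub>T4B\<^esub> slots B [0, 2, 1, 3] (insert_at B 3 0 (\<lambda>e. b3 [e, y, w]) A 2 (b00 (x, z)))
          \<ominus>\<^bsub>T4B\<^esub> slots B [0, 3, 1, 2] (insert_at B 3 0 (\<lambda>e. b3 [e, y, z]) A 2 (b00 (x, w)))
          \<ominus>\<^bsub>T4B\<^esub> slots B [1, 2, 0, 3] (insert_at B 3 0 (\<lambda>e. b3 [e, x, w]) A 2 (b00 (y, z)))
          \<oplus>\<^bsub>T4B\<^esub> slots B [1, 3, 0, 2] (insert_at B 3 0 (\<lambda>e. b3 [e, x, z]) A 2 (b00 (y, w)))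
          \<ominus>\<^bsub>T4B\<^esub> slots B [2, 3, 0, 1] (insert_at B 3 0 (\<lambda>e. b3 [e, x, y]) A 2 (b00 (z, w)))
        = \<zero>\<^bsub>T4B\<^esub>))"

definition skeletal :: "('h, 'l, 'm) two_term \<Rightarrow> bool" where
  "skeletal V \<longleftrightarrow> L_infinity V \<and> (\<forall>u\<in>carrier (L1 V). beta1 V u = \<zero>\<^bsub>L0 V\<^esub>)"

end

end

theory Submission
  imports Defs
begin

text \<open>
  In a skeletal pseudoalgebra \<open>\<beta>\<^sub>1 = 0\<close>, so every term containing \<open>\<beta>\<^sub>1\<close> vanishes: (i) and (ii) become
  trivial, (iii) and (iv) become the Jacobi identity and the representation identity, and (v) is
  the vanishing of the coboundary of \<open>\<beta>\<^sub>3\<close>, expanded.  The remaining data \<open>\<beta>\<^sub>1\<close> and the component of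
  \<open>\<beta>\<^sub>2\<close> on \<open>\<L>\<^sub>1 \<boxtimes> \<L>\<^sub>0\<close> are determined by the triple.  Conversely, that component has to be recovered
  from the action as \<open>-\<sigma> (x * u)\<close>, where \<open>\<sigma>\<close> exchanges the two factors of \<open>H\<close>.  Its polylinearity
  requires \<open>\<sigma>\<close> to descend to \<open>H\<^sup>\<otimes>\<^sup>2 \<otimes>\<^sub>H M\<close>, which it does because \<open>\<sigma>\<close> is an algebra map fixing \<open>\<Delta> h\<close>.
\<close>

section \<open>Additive maps and presented groups\<close>

text \<open>Every \<open>tpow_ext\<close> or \<open>htensor_ext\<close> is a sum over an arbitrarily
  chosen expression, so its value is known only once an additive map with the prescribed values on
  generators is known to exist. Such maps come from the universal property of a group given by
  generators and relations. On \<open>H\<^sup>\<otimes>\<^sup>n \<otimes>\<^sub>H M\<close> the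
  value is needed for four operations only: the module action, the exchange of two factors, the
  trivial rearrangement of slots, and the map induced by zero. The composites in the Jacobi
  identity, the representation identity and the cocycle condition never have to be evaluated: both
  structures contain the same expressions literally, so it is enough that these lie in the carrier,
  which holds for every choice. The correspondence is a bijection of sets of functions, not merely
  up to agreement on carriers, because all maps are \<open>undefined\<close> outside the carriers; a
  structure map known there is known as a function.\<close>

abbreviation add_hom :: "('a, 'c) ring_scheme \<Rightarrow> ('b, 'd) ring_scheme \<Rightarrow> ('a \<Rightarrow> 'b) set" where
  "add_hom G G' \<equiv> hom (add_monoid G) (add_monoid G')"

lemma add_homI:
  assumes "\<And>x. x \<in> carrier G \<Longrightarrow> h x \<in> carrier G'"
    and "\<And>x y. \<lbrakk>x \<in> carrier G; y \<in> carrier G\<rbrakk> \<Longrightarrow> h (x \<oplus>\<^bsub>G\<^esub> y) = h x \<oplus>\<^bsub>G'\<^esub> h y"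
  shows "h \<in> add_hom G G'"
  using assms by (auto simp: hom_def)

lemma add_hom_closed: "\<lbrakk>h \<in> add_hom G G'; x \<in> carrier G\<rbrakk> \<Longrightarrow> h x \<in> carrier G'"
  by (auto simp: hom_def)

lemma add_hom_add:
  "\<lbrakk>h \<in> add_hom G G'; x \<in> carrier G; y \<in> carrier G\<rbrakk> \<Longrightarrow> h (x \<oplus>\<^bsub>G\<^esub> y) = h x \<oplus>\<^bsub>G'\<^esub> h y"
  by (auto simp: hom_def)

lemma add_hom_compose:
  "\<lbrakk>h \<in> add_hom G G'; k \<in> add_hom G' G''\<rbrakk> \<Longrightarrow> (\<lambda>x. k (h x)) \<in> add_hom G G''"
  by (auto simp: hom_def Pi_iff)

lemma add_hom_zero:
  assumes "abelian_group G" "abelian_group G'" "h \<in> add_hom G G'"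
  shows "h \<zero>\<^bsub>G\<^esub> = \<zero>\<^bsub>G'\<^esub>"
  using hom_one[OF assms(3) abelian_group.a_group[OF assms(1)] abelian_group.a_group[OF assms(2)]]
  by simp

lemma add_hom_minus:
  assumes G: "abelian_group G" "abelian_group G'" and h: "h \<in> add_hom G G'" and x: "x \<in> carrier G"
  shows "h (\<ominus>\<^bsub>G\<^esub> x) = \<ominus>\<^bsub>G'\<^esub> h x"
proof -
  interpret G: abelian_group G by fact
  interpret G': abelian_group G' by fact
  have "h (\<ominus>\<^bsub>G\<^esub> x) \<oplus>\<^bsub>G'\<^esub> h x = \<zero>\<^bsub>G'\<^esub>"
    using add_hom_add[OF h, of "\<ominus>\<^bsub>G\<^esub> x" x] add_hom_zero[OF G h] x by (simp add: G.l_neg)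
  then show ?thesis
    using G'.minus_equality add_hom_closed[OF h] x by simp
qed

lemma add_hom_diff:
  assumes "abelian_group G" "abelian_group G'" "h \<in> add_hom G G'" "x \<in> carrier G" "y \<in> carrier G"
  shows "h (x \<ominus>\<^bsub>G\<^esub> y) = h x \<ominus>\<^bsub>G'\<^esub> h y"
  using assms by (simp add: a_minus_def add_hom_add add_hom_minus abelian_group.a_inv_closed)

text \<open>\<open>presented\<close> fills only the additive fields, while
  \<open>tensor_power\<close> and \<open>htensor\<close> are records with further operations but the
  same carrier, sum and zero. This carries the group structure over to them.\<close>

lemma abelian_group_cong:
  assumes "abelian_group G" "carrier G' = carrier G" "ring.add G' = ring.add G" "ring.zero G' = ring.zero G"
  shows "abelian_group G'"
  using abelian_groupE[OF assms(1)] by (intro abelian_groupI) (simp_all only: assms(2-4))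

lemma list_sum_simps [simp]:
  "list_sum G [] = \<zero>\<^bsub>G\<^esub>"
  "list_sum G (x # xs) = x \<oplus>\<^bsub>G\<^esub> list_sum G xs"
  by (simp_all add: list_sum_def)

context abelian_group
begin

lemma minus_eq_zero_iff: "\<lbrakk>a \<in> carrier G; b \<in> carrier G\<rbrakk> \<Longrightarrow> a \<ominus> b = \<zero> \<longleftrightarrow> a = b"
  by (metis a_minus_def add.inv_closed minus_equality r_neg)

lemma minus_zero: "\<ominus> \<zero> = \<zero>"
  by (rule minus_equality) auto

lemma add_minus_minus: "\<lbrakk>a \<in> carrier G; b \<in> carrier G\<rbrakk> \<Longrightarrow> a \<oplus> b \<ominus> a \<ominus> b = \<zero>"
  by (simp add: a_minus_def a_comm[of a b] a_assoc r_neg)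

lemma list_sum_closed: "set xs \<subseteq> carrier G \<Longrightarrow> list_sum G xs \<in> carrier G"
  by (induction xs) auto

lemma list_sum_append:
  "\<lbrakk>set xs \<subseteq> carrier G; set ys \<subseteq> carrier G\<rbrakk> \<Longrightarrow>
    list_sum G (xs @ ys) = list_sum G xs \<oplus> list_sum G ys"
  by (induction xs) (auto simp: a_assoc list_sum_closed)

lemma list_sum_minus:
  "set xs \<subseteq> carrier G \<Longrightarrow> list_sum G (map (\<lambda>x. \<ominus> x) xs) = \<ominus> list_sum G xs"
  by (induction xs) (auto simp: minus_add list_sum_closed minus_zero)

lemma add_hom_plus:
  assumes "f \<in> add_hom G' G" "g \<in> add_hom G' G"
  shows "(\<lambda>x. f x \<oplus> g x) \<in> add_hom G' G"
  using assms by (intro add_homI) (auto simp: add_hom_add add_hom_closed a_ac)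

end

lemma add_hom_list_sum:
  assumes "abelian_group G" "abelian_group G'" "h \<in> add_hom G G'" "set xs \<subseteq> carrier G"
  shows "h (list_sum G xs) = list_sum G' (map h xs)"
  using assms(4)
  by (induction xs) (auto simp: add_hom_zero[OF assms(1-3)] add_hom_add[OF assms(3)]
      abelian_group.list_sum_closed[OF assms(1)])

lemma frag_of_diff_diff_closed:
  "\<lbrakk>a \<in> S; b \<in> S; c \<in> S\<rbrakk> \<Longrightarrow> frag_of a - frag_of b - frag_of c \<in> carrier (free_Abelian_group S)"
  using keys_diff[of "frag_of a - frag_of b" "frag_of c"] keys_diff[of "frag_of a" "frag_of b"]
  by auto

lemma frag_of_diff_closed: "\<lbrakk>a \<in> S; b \<in> S\<rbrakk> \<Longrightarrow> frag_of a - frag_of b \<in> carrier (free_Abelian_group S)"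
  using keys_diff[of "frag_of a" "frag_of b"] by auto

section \<open>Abelian groups given by generators and relations\<close>

locale presentation =
  fixes S :: "'a set" and R :: "('a \<Rightarrow>\<^sub>0 int) set"
  assumes rels: "R \<subseteq> carrier (free_Abelian_group S)"
begin

abbreviation "F \<equiv> free_Abelian_group S"
abbreviation "N \<equiv> generate F R"
abbreviation "P \<equiv> presented S R"
abbreviation "cls \<equiv> presented_class S R"

lemma normal_N: "N \<lhd> F"
  using comm_group.subgroup_imp_normal[OF abelian_free_Abelian_group]
    group.generate_is_subgroup[OF group_free_Abelian_group rels] by blast

lemma add_monoid_P: "add_monoid P = F Mod N"
  by (simp add: presented_def Let_def)

lemma carrier_P: "carrier P = (\<lambda>c. N #>\<^bsub>F\<^esub> c) ` carrier F"
  by (simp add: presented_def Let_def carrier_FactGroup)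

lemma abelian_group_P: "abelian_group P"
proof -
  have "comm_group (F Mod N)"
    using comm_group.abelian_FactGroup[OF abelian_free_Abelian_group]
      group.generate_is_subgroup[OF group_free_Abelian_group rels] by blast
  then have "comm_group (add_monoid P)"
    by (simp only: add_monoid_P)
  then show ?thesis
    by (simp add: abelian_group_def abelian_monoid_def abelian_group_axioms_def comm_group_def)
qed

sublocale P: abelian_group P
  by (rule abelian_group_P)

lemma coset_hom: "(\<lambda>c. N #>\<^bsub>F\<^esub> c) \<in> hom F (add_monoid P)"
  using normal.r_coset_hom_Mod[OF normal_N] by (simp only: add_monoid_P)

lemma hom_diff:
  assumes "abelian_group G" "h \<in> hom F (add_monoid G)" "a \<in> carrier F" "b \<in> carrier F"
  shows "h (a - b) = h a \<ominus>\<^bsub>G\<^esub> h b"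
proof -
  interpret G: abelian_group G by fact
  interpret group_hom F "add_monoid G" h
    using assms(2) G.a_group by (simp add: group_hom_def group_hom_axioms_def)
  have "h (a - b) = h (a \<otimes>\<^bsub>F\<^esub> inv\<^bsub>F\<^esub> b)"
    using assms by simp
  also have "\<dots> = h a \<otimes>\<^bsub>add_monoid G\<^esub> inv\<^bsub>add_monoid G\<^esub> (h b)"
    using assms(3,4) by (metis hom_mult hom_inv G.inv_closed)
  finally show ?thesis
    by (simp add: a_minus_def a_inv_def)
qed

text \<open>Covers relators of the form \<open>frag_of a - frag_of b\<close>, the shape of the
  scalar and balancing relations; \<open>hom_add_rel\<close> covers the additive ones. Together they
  discharge the hypothesis \<open>kill\<close> of \<open>universal\<close>.\<close>

lemma hom_diff_rel:
  assumes "abelian_group G" "h \<in> hom F (add_monoid G)" "a \<in> S" "b \<in> S"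
    and "h (frag_of a) = h (frag_of b)"
  shows "h (frag_of a - frag_of b) = \<zero>\<^bsub>G\<^esub>"
proof -
  interpret G: abelian_group G by fact
  have "h (frag_of b) \<in> carrier G"
    using hom_in_carrier[OF assms(2), of "frag_of b"] assms(4) by simp
  then show ?thesis
    using assms(3-5) by (simp add: hom_diff[OF assms(1,2)] a_minus_def G.r_neg)
qed

lemma hom_add_rel:
  assumes "abelian_group G" "h \<in> hom F (add_monoid G)" "a \<in> S" "b \<in> S" "c \<in> S"
    and "h (frag_of a) = h (frag_of b) \<oplus>\<^bsub>G\<^esub> h (frag_of c)"
  shows "h (frag_of a - frag_of b - frag_of c) = \<zero>\<^bsub>G\<^esub>"
proof -
  have "h (frag_of b) \<in> carrier G" "h (frag_of c) \<in> carrier G"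
    using hom_in_carrier[OF assms(2), of "frag_of b"] hom_in_carrier[OF assms(2), of "frag_of c"]
      assms(4,5) by simp_all
  then show ?thesis
    using assms(3-6) frag_of_diff_closed[OF assms(3,4)]
    by (simp add: hom_diff[OF assms(1,2)] abelian_group.add_minus_minus[OF assms(1)])
qed

lemma coset_rel: "r \<in> R \<Longrightarrow> N #>\<^bsub>F\<^esub> r = \<zero>\<^bsub>P\<^esub>"
  using group.coset_join2[OF group_free_Abelian_group, of r S N] rels
    group.generate_is_subgroup[OF group_free_Abelian_group rels] generate.incl[of r R F]
  by (auto simp: presented_def Let_def)

lemma cls_closed [simp]: "s \<in> S \<Longrightarrow> cls s \<in> carrier P"
  by (auto simp: carrier_P presented_class_def)

lemma cls_diff_rel:
  assumes "frag_of a - frag_of b \<in> R" "a \<in> S" "b \<in> S"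
  shows "cls a = cls b"
proof -
  have "cls a \<ominus>\<^bsub>P\<^esub> cls b = \<zero>\<^bsub>P\<^esub>"
    using hom_diff[OF abelian_group_P coset_hom, of "frag_of a" "frag_of b"] coset_rel[OF assms(1)] assms
    by (simp add: presented_class_def)
  then show ?thesis
    using P.minus_eq_zero_iff assms by auto
qed

lemma cls_add_rel:
  assumes "frag_of a - frag_of b - frag_of c \<in> R" "a \<in> S" "b \<in> S" "c \<in> S"
  shows "cls a = cls b \<oplus>\<^bsub>P\<^esub> cls c"
proof -
  have "frag_of a - frag_of b \<in> carrier F"
    using assms keys_diff[of "frag_of a" "frag_of b"] by auto
  then have "cls a \<ominus>\<^bsub>P\<^esub> cls b \<ominus>\<^bsub>P\<^esub> cls c = \<zero>\<^bsub>P\<^esub>"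
    using hom_diff[OF abelian_group_P coset_hom] coset_rel[OF assms(1)] assms
    by (simp add: presented_class_def)
  then have "cls a \<ominus>\<^bsub>P\<^esub> cls b = cls c"
    using assms by (meson P.minus_closed P.minus_eq_zero_iff cls_closed)
  moreover have "cls a = cls b \<oplus>\<^bsub>P\<^esub> (cls a \<ominus>\<^bsub>P\<^esub> cls b)"
    using assms by (simp add: a_minus_def P.a_lcomm P.r_neg)
  ultimately show ?thesis by simp
qed

text \<open>The induction rule of the free abelian group works with differences, and the coset map
  preserves them; hence a closure hypothesis for differences instead of sums and negatives.\<close>

lemma span_induct:
  assumes "x \<in> carrier P" and zero: "Q \<zero>\<^bsub>P\<^esub>" and cls: "\<And>s. s \<in> S \<Longrightarrow> Q (cls s)"
    and diff: "\<And>a b. \<lbrakk>a \<in> carrier P; b \<in> carrier P; Q a; Q b\<rbrakk> \<Longrightarrow> Q (a \<ominus>\<^bsub>P\<^esub> b)"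
  shows "Q x"
proof -
  obtain c where c: "Poly_Mapping.keys c \<subseteq> S" "x = N #>\<^bsub>F\<^esub> c"
    using assms(1) by (auto simp: carrier_P)
  from c(1) have "Q (N #>\<^bsub>F\<^esub> c)"
  proof (induction c rule: free_Abelian_group_induct[consumes 1, case_names zero diff single])
    case zero
    then show ?case
      using assms(2) hom_one[OF coset_hom group_free_Abelian_group P.a_group] by simp
  next
    case (diff a b)
    then show ?case
      using hom_diff[OF abelian_group_P coset_hom, of a b] assms(4) by (simp add: carrier_P)
  next
    case (single s)
    then show ?case
      using cls by (simp add: presented_class_def)
  qed
  with c show ?thesis by simp
qed

text \<open>The extension to the free group has a subgroup as kernel, so killing the relators it
  kills the generated subgroup and factors through the quotient. In \<open>kill\<close> the
  extension is an arbitrary homomorphism with the right values on generators, so a user checks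
  relators without constructing it.\<close>

lemma universal:
  assumes G: "abelian_group G" and f: "\<And>s. s \<in> S \<Longrightarrow> f s \<in> carrier G"
    and kill: "\<And>r h. \<lbrakk>r \<in> R; h \<in> hom F (add_monoid G); \<And>s. s \<in> S \<Longrightarrow> h (frag_of s) = f s\<rbrakk>
      \<Longrightarrow> h r = \<zero>\<^bsub>G\<^esub>"
  obtains g where "g \<in> add_hom P G" "\<And>s. s \<in> S \<Longrightarrow> g (cls s) = f s"
proof -
  interpret G: abelian_group G by fact
  obtain h where h: "h \<in> hom F (add_monoid G)" "\<And>s. s \<in> S \<Longrightarrow> h (frag_of s) = f s"
    using comm_group.free_Abelian_group_universal[OF G.a_comm_group, of f S] f by auto
  interpret group_hom F "add_monoid G" h
    using h(1) G.a_group by (simp add: group_hom_def group_hom_axioms_def)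
  have "R \<subseteq> kernel F (add_monoid G) h"
    using kill h subsetD[OF rels] by (simp add: kernel_def subset_iff)
  then have "N \<subseteq> kernel F (add_monoid G) h"
    using subgroup_kernel group.generate_subgroup_incl[OF group_free_Abelian_group] by blast
  then obtain g where "g \<in> hom (F Mod N) (add_monoid G)" "\<And>c. c \<in> carrier F \<Longrightarrow> g (N #>\<^bsub>F\<^esub> c) = h c"
    using FactGroup_universal_kernel[OF normal_N] by blast
  then show thesis
    using that h(2) by (simp add: presented_class_def flip: add_monoid_P del: monoid.simps partial_object.simps)
qed

end

section \<open>Tensor powers\<close>

context hopf_signature
begin

text \<open>The conditions under which \<open>f\<close> respects \<open>tpow_rels\<close>. Since
  \<open>G\<close> is only an abelian group, linearity over \<open>K\<close> appears as balancing: a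
  scalar may be moved from one factor to another.\<close>

definition multilinear :: "nat \<Rightarrow> ('b, 'c) ring_scheme \<Rightarrow> ('h list \<Rightarrow> 'b) \<Rightarrow> bool" where
  "multilinear n G f \<longleftrightarrow>
    (\<forall>hs\<in>words n. f hs \<in> carrier G) \<and>
    (\<forall>hs\<in>words n. \<forall>i<n. \<forall>a\<in>carrier H. \<forall>b\<in>carrier H.
      f (hs[i := a \<oplus>\<^bsub>H\<^esub> b]) = f (hs[i := a]) \<oplus>\<^bsub>G\<^esub> f (hs[i := b])) \<and>
    (\<forall>hs\<in>words n. \<forall>i<n. \<forall>j<n. \<forall>c\<in>carrier K.
      f (hs[i := c \<odot>\<^bsub>H\<^esub> (hs ! i)]) = f (hs[j := c \<odot>\<^bsub>H\<^esub> (hs ! j)]))"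

lemma words_update: "\<lbrakk>hs \<in> words n; a \<in> carrier H\<rbrakk> \<Longrightarrow> hs[i := a] \<in> words n"
  using set_update_subset_insert[of hs i a] by (auto simp: words_def)

lemma words_nth: "\<lbrakk>hs \<in> words n; i < n\<rbrakk> \<Longrightarrow> hs ! i \<in> carrier H"
  by (auto simp: words_def)

lemma words_length: "hs \<in> words n \<Longrightarrow> length hs = n"
  by (simp add: words_def)

lemma words_1E:
  assumes "hs \<in> words (Suc 0)"
  obtains a where "hs = [a]" "a \<in> carrier H"
  using assms by (auto simp: words_def length_Suc_conv)

lemma words_2E:
  assumes "hs \<in> words 2"
  obtains a b where "hs = [a, b]" "a \<in> carrier H" "b \<in> carrier H"
  using assms by (auto simp: words_def length_Suc_conv numeral_2_eq_2)

lemma multilinear_closed: "\<lbrakk>multilinear n G f; hs \<in> words n\<rbrakk> \<Longrightarrow> f hs \<in> carrier G"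
  by (simp add: multilinear_def)

lemma multilinear_add:
  "\<lbrakk>multilinear n G f; hs \<in> words n; i < n; a \<in> carrier H; b \<in> carrier H\<rbrakk> \<Longrightarrow>
    f (hs[i := a \<oplus>\<^bsub>H\<^esub> b]) = f (hs[i := a]) \<oplus>\<^bsub>G\<^esub> f (hs[i := b])"
  by (simp add: multilinear_def)

lemma multilinear_smult:
  "\<lbrakk>multilinear n G f; hs \<in> words n; i < n; j < n; c \<in> carrier K\<rbrakk> \<Longrightarrow>
    f (hs[i := c \<odot>\<^bsub>H\<^esub> (hs ! i)]) = f (hs[j := c \<odot>\<^bsub>H\<^esub> (hs ! j)])"
  unfolding multilinear_def by blast

lemma list_sum_cong:
  "\<lbrakk>ring.add G = ring.add G'; ring.zero G = ring.zero G'\<rbrakk> \<Longrightarrow> list_sum G = list_sum G'"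
  by (rule ext) (simp add: list_sum_def)

lemma tpow_add_simps [simp]:
  "carrier (tpow_add n) = carrier (tensor_power n)"
  "ring.add (tpow_add n) = ring.add (tensor_power n)"
  "ring.zero (tpow_add n) = ring.zero (tensor_power n)"
  by (simp_all add: tensor_power_def)

lemma list_sum_tpow_add [simp]: "list_sum (tpow_add n) = list_sum (tensor_power n)"
  by (rule list_sum_cong) simp_all

lemma tpow_ext_tpow_add [simp]: "tpow_ext m (tpow_add n) = tpow_ext m (tensor_power n)"
  by (simp add: tpow_ext_def fun_eq_iff)

end

context cocommutative_hopf_algebra
begin

lemmas H_smult_closed [simp] = module.smult_closed[OF vector_space]

sublocale tpow: presentation "words n" "tpow_rels n" for n
proof
  show "tpow_rels n \<subseteq> carrier (free_Abelian_group (words n))"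
    unfolding tpow_rels_def
    by (intro Un_least subsetI; elim CollectE exE conjE; hypsubst)
      (intro frag_of_diff_diff_closed frag_of_diff_closed words_update H.a_closed H_smult_closed; simp add: words_nth)+
qed

lemma abelian_group_tensor_power: "abelian_group (tensor_power n)"
  by (rule abelian_group_cong[OF tpow.abelian_group_P[of n]]) (simp_all add: tensor_power_def tpow_add_def)

sublocale tp: abelian_group "tensor_power n" for n
  by (rule abelian_group_tensor_power)

lemma tensor_power_eq:
  "carrier (presented (words n) (tpow_rels n)) = carrier (tensor_power n)"
  "ring.add (presented (words n) (tpow_rels n)) = ring.add (tensor_power n)"
  "ring.zero (presented (words n) (tpow_rels n)) = ring.zero (tensor_power n)"
  "a_inv (presented (words n) (tpow_rels n)) = a_inv (tensor_power n)"
  "a_minus (presented (words n) (tpow_rels n)) = a_minus (tensor_power n)"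
  by (simp_all add: tensor_power_def tpow_add_def a_inv_def m_inv_def a_minus_def fun_eq_iff)

lemma tens_eq: "hs \<in> words n \<Longrightarrow> tens hs = presented_class (words n) (tpow_rels n) hs"
  by (simp add: tens_def words_length)

lemma tens_closed: "hs \<in> words n \<Longrightarrow> tens hs \<in> carrier (tensor_power n)"
  using tpow.cls_closed[of hs n] by (simp add: tens_eq tensor_power_eq)

lemma multilinear_tens: "multilinear n (tensor_power n) tens"
  unfolding multilinear_def
proof (intro conjI ballI allI impI)
  fix hs i a b
  assume *: "hs \<in> words n" "i < n" "a \<in> carrier H" "b \<in> carrier H"
  then have "frag_of (hs[i := a \<oplus>\<^bsub>H\<^esub> b]) - frag_of (hs[i := a]) - frag_of (hs[i := b]) \<in> tpow_rels n"
    unfolding tpow_rels_def by blast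
  from tpow.cls_add_rel[OF this] * show
    "tens (hs[i := a \<oplus>\<^bsub>H\<^esub> b]) = tens (hs[i := a]) \<oplus>\<^bsub>tensor_power n\<^esub> tens (hs[i := b])"
    by (simp add: tens_eq[of _ n] words_update tensor_power_eq)
next
  fix hs i j c
  assume *: "hs \<in> words n" "i < n" "j < n" "c \<in> carrier K"
  then have "frag_of (hs[i := c \<odot>\<^bsub>H\<^esub> (hs ! i)]) - frag_of (hs[j := c \<odot>\<^bsub>H\<^esub> (hs ! j)]) \<in> tpow_rels n"
    unfolding tpow_rels_def by blast
  from tpow.cls_diff_rel[OF this] * show
    "tens (hs[i := c \<odot>\<^bsub>H\<^esub> (hs ! i)]) = tens (hs[j := c \<odot>\<^bsub>H\<^esub> (hs ! j)])"
    by (simp add: tens_eq[of _ n] words_update words_nth)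
qed (rule tens_closed)

lemma multilinear_minus:
  assumes f: "multilinear n G f" and G: "abelian_group G"
    and hs: "hs \<in> words n" "i < n" "a \<in> carrier H"
  shows "f (hs[i := \<ominus>\<^bsub>H\<^esub> a]) = \<ominus>\<^bsub>G\<^esub> f (hs[i := a])"
proof -
  have "(\<lambda>a. f (hs[i := a])) \<in> add_hom H G"
    using multilinear_add[OF f hs(1,2)] multilinear_closed[OF f] words_update[OF hs(1)]
    by (intro add_homI) auto
  from add_hom_minus[OF H.is_abelian_group G this hs(3)] show ?thesis .
qed

lemma tpow_rep_append:
  assumes "tpow_rep n T ps" "tpow_rep n U qs"
  shows "tpow_rep n (T \<oplus>\<^bsub>tensor_power n\<^esub> U) (ps @ qs)"
proof -
  have "set (map tens xs) \<subseteq> carrier (tensor_power n)" if "set xs \<subseteq> words n" for xs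
    using that tens_closed by auto
  then show ?thesis
    using assms by (auto simp: tpow_rep_def tp.list_sum_append)
qed

text \<open>Expressions carry no signs, so a sign is absorbed into factor 0 of each word; this is
  where \<open>n > 0\<close> enters.\<close>

lemma tpow_rep_minus:
  assumes "tpow_rep n T ps" "n > 0"
  shows "tpow_rep n (\<ominus>\<^bsub>tensor_power n\<^esub> T) (map (\<lambda>hs. hs[0 := \<ominus>\<^bsub>H\<^esub> (hs ! 0)]) ps)"
proof -
  have ps: "set ps \<subseteq> words n"
    using assms by (simp add: tpow_rep_def)
  have "tens (hs[0 := \<ominus>\<^bsub>H\<^esub> (hs ! 0)]) = \<ominus>\<^bsub>tensor_power n\<^esub> tens hs" if "hs \<in> words n" for hs
    using multilinear_minus[OF multilinear_tens tp.abelian_group_axioms that, of 0 "hs ! 0"] that assms(2)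
    by (simp add: words_nth)
  then have "map (\<lambda>hs. tens (hs[0 := \<ominus>\<^bsub>H\<^esub> (hs ! 0)])) ps =
      map (\<lambda>x. \<ominus>\<^bsub>tensor_power n\<^esub> x) (map tens ps)"
    using ps by auto
  moreover have "set (map tens ps) \<subseteq> carrier (tensor_power n)"
    using ps tens_closed by auto
  moreover have "(\<lambda>hs. hs[0 := \<ominus>\<^bsub>H\<^esub> (hs ! 0)]) ` set ps \<subseteq> words n"
    using ps assms(2) by (auto intro!: words_update words_nth)
  ultimately show ?thesis
    using assms(1) tp.list_sum_minus[of "map tens ps" n]
    by (simp only: tpow_rep_def comp_def set_map map_map list_sum_tpow_add)
qed

text \<open>For \<open>n = 0\<close> there is no factor to absorb a sign, so negative elements have no expression.\<close>

lemma tpow_rep_exists: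
  assumes "n > 0" "T \<in> carrier (tensor_power n)"
  shows "\<exists>ps. tpow_rep n T ps"
proof -
  have "T \<in> carrier (presented (words n) (tpow_rels n))"
    using assms by (simp add: tensor_power_eq)
  then show ?thesis
  proof (rule tpow.span_induct)
    show "\<exists>ps. tpow_rep n \<zero>\<^bsub>presented (words n) (tpow_rels n)\<^esub> ps"
      by (intro exI[of _ "[]"]) (simp add: tpow_rep_def tensor_power_eq)
    show "\<exists>ps. tpow_rep n (presented_class (words n) (tpow_rels n) hs) ps" if "hs \<in> words n" for hs
      using that tens_closed[OF that]
      by (intro exI[of _ "[hs]"]) (simp add: tpow_rep_def tens_eq)
    show "\<exists>ps. tpow_rep n (a \<ominus>\<^bsub>presented (words n) (tpow_rels n)\<^esub> b) ps"
      if "\<exists>ps. tpow_rep n a ps" "\<exists>ps. tpow_rep n b ps" for a b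
      using that tpow_rep_append[OF _ tpow_rep_minus[OF _ assms(1)]]
      unfolding tensor_power_eq a_minus_def by blast
  qed
qed

text \<open>Words generate the group once differences are allowed, so no signless expression is
  required and the statement covers every \<open>n\<close>.\<close>

lemma tpow_hom_eqI:
  assumes "abelian_group G" "f \<in> add_hom (tensor_power n) G" "g \<in> add_hom (tensor_power n) G"
    and "\<And>hs. hs \<in> words n \<Longrightarrow> f (tens hs) = g (tens hs)"
    and "T \<in> carrier (tensor_power n)"
  shows "f T = g T"
proof -
  have "T \<in> carrier (presented (words n) (tpow_rels n))"
    using assms by (simp add: tensor_power_eq)
  then show ?thesis
  proof (rule tpow.span_induct)
    show "f \<zero>\<^bsub>presented (words n) (tpow_rels n)\<^esub> = g \<zero>\<^bsub>presented (words n) (tpow_rels n)\<^esub>"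
      by (simp add: tensor_power_eq add_hom_zero[OF tp.abelian_group_axioms assms(1,2)]
          add_hom_zero[OF tp.abelian_group_axioms assms(1,3)])
    show "f (presented_class (words n) (tpow_rels n) hs) = g (presented_class (words n) (tpow_rels n) hs)"
      if "hs \<in> words n" for hs
      using assms(4)[OF that] that by (simp add: tens_eq)
  qed (simp_all add: tensor_power_eq add_hom_diff[OF tp.abelian_group_axioms assms(1,2)]
      add_hom_diff[OF tp.abelian_group_axioms assms(1,3)])
qed

lemma tpow_rep_some:
  assumes "n > 0" "T \<in> carrier (tensor_power n)"
  shows "tpow_rep n T (SOME ps. tpow_rep n T ps)"
  using tpow_rep_exists[OF assms] by (rule someI_ex)

text \<open>Here \<open>f\<close> is any function on words: whichever expression is chosen, the sum
  stays in \<open>G\<close>.\<close>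

lemma tpow_ext_closed:
  assumes "abelian_group G" "n > 0" "T \<in> carrier (tensor_power n)"
    and "\<And>hs. hs \<in> words n \<Longrightarrow> f hs \<in> carrier G"
  shows "tpow_ext n G f T \<in> carrier G"
  using tpow_rep_some[OF assms(2,3)] assms(4) unfolding tpow_ext_def tpow_rep_def
  by (intro abelian_group.list_sum_closed[OF assms(1)]) auto

lemma tpow_ext_cong:
  assumes "n > 0" "T \<in> carrier (tensor_power n)" "\<And>hs. hs \<in> words n \<Longrightarrow> f hs = g hs"
  shows "tpow_ext n G f T = tpow_ext n G g T"
  using tpow_rep_some[OF assms(1,2)] assms(3) unfolding tpow_ext_def tpow_rep_def
  by (intro arg_cong[of _ _ "list_sum G"] map_cong) auto

text \<open>Removes the choice: an additive \<open>h\<close> sends every expression of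
  \<open>T\<close> to the corresponding sum of values of \<open>f\<close>, so the chosen sum is
  \<open>h T\<close>.\<close>

lemma tpow_ext_eq:
  assumes "abelian_group G" "n > 0" "T \<in> carrier (tensor_power n)" "h \<in> add_hom (tensor_power n) G"
    and "\<And>hs. hs \<in> words n \<Longrightarrow> h (tens hs) = f hs"
  shows "tpow_ext n G f T = h T"
proof -
  define ps where "ps = (SOME ps. tpow_rep n T ps)"
  have ps: "set ps \<subseteq> words n" "T = list_sum (tensor_power n) (map tens ps)"
    using tpow_rep_some[OF assms(2,3)] by (simp_all add: ps_def tpow_rep_def)
  have "h T = list_sum G (map h (map tens ps))"
    using ps tens_closed by (subst ps(2), intro add_hom_list_sum tp.abelian_group_axioms assms) auto
  also have "map h (map tens ps) = map f ps"
    using ps assms(5) by auto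
  finally show ?thesis
    by (simp add: tpow_ext_def ps_def)
qed

lemma tpow_universal:
  assumes G: "abelian_group G" and f: "multilinear n G f"
  obtains h where "h \<in> add_hom (tensor_power n) G" "\<And>hs. hs \<in> words n \<Longrightarrow> h (tens hs) = f hs"
proof -
  obtain h where "h \<in> add_hom (presented (words n) (tpow_rels n)) G"
    "\<And>hs. hs \<in> words n \<Longrightarrow> h (presented_class (words n) (tpow_rels n) hs) = f hs"
  proof (rule tpow.universal[OF G, of n f])
    show "f hs \<in> carrier G" if "hs \<in> words n" for hs
      using f that by (rule multilinear_closed)
    fix r h
    assume h: "h \<in> hom (free_Abelian_group (words n)) (add_monoid G)"
      and hf: "\<And>hs. hs \<in> words n \<Longrightarrow> h (frag_of hs) = f hs"
    assume "r \<in> tpow_rels n"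
    then show "h r = \<zero>\<^bsub>G\<^esub>"
      unfolding tpow_rels_def
    proof (elim UnE CollectE exE conjE)
      fix hs i a b
      assume r: "r = frag_of (hs[i := a \<oplus>\<^bsub>H\<^esub> b]) - frag_of (hs[i := a]) - frag_of (hs[i := b])"
        and *: "hs \<in> words n" "i < n" "a \<in> carrier H" "b \<in> carrier H"
      have w: "hs[i := a \<oplus>\<^bsub>H\<^esub> b] \<in> words n" "hs[i := a] \<in> words n" "hs[i := b] \<in> words n"
        using * by (auto intro: words_update)
      show ?thesis
        unfolding r using w multilinear_add[OF f *] by (intro tpow.hom_add_rel[OF G h]) (simp_all add: hf)
    next
      fix hs i j c
      assume r: "r = frag_of (hs[i := c \<odot>\<^bsub>H\<^esub> (hs ! i)]) - frag_of (hs[j := c \<odot>\<^bsub>H\<^esub> (hs ! j)])"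
        and *: "hs \<in> words n" "i < n" "j < n" "c \<in> carrier K"
      have w: "hs[i := c \<odot>\<^bsub>H\<^esub> (hs ! i)] \<in> words n" "hs[j := c \<odot>\<^bsub>H\<^esub> (hs ! j)] \<in> words n"
        using * by (auto intro!: words_update simp: words_nth)
      show ?thesis
        unfolding r using w multilinear_smult[OF f *] by (intro tpow.hom_diff_rel[OF G h]) (simp_all add: hf)
    qed
  qed blast
  then show thesis
    using that by (simp add: tens_eq tensor_power_eq hom_def)
qed

lemma tpow_ext_hom:
  assumes "abelian_group G" "n > 0" "multilinear n G f"
  shows "tpow_ext n G f \<in> add_hom (tensor_power n) G"
proof -
  obtain h where h: "h \<in> add_hom (tensor_power n) G" "\<And>hs. hs \<in> words n \<Longrightarrow> h (tens hs) = f hs"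
    using tpow_universal[OF assms(1,3)] by blast
  then have "tpow_ext n G f T = h T" if "T \<in> carrier (tensor_power n)" for T
    using tpow_ext_eq assms that by blast
  then show ?thesis
    using h(1) by (intro add_homI) (auto simp: add_hom_closed add_hom_add)
qed

lemma tpow_ext_tens:
  assumes "abelian_group G" "n > 0" "multilinear n G f" "hs \<in> words n"
  shows "tpow_ext n G f (tens hs) = f hs"
proof -
  obtain h where h: "h \<in> add_hom (tensor_power n) G" "\<And>hs. hs \<in> words n \<Longrightarrow> h (tens hs) = f hs"
    using tpow_universal[OF assms(1,3)] by blast
  then show ?thesis
    using tpow_ext_eq[OF assms(1,2) tens_closed[OF assms(4)] h(1), of f] assms(4) by simp
qed

section \<open>Multiplication, comultiplication and the flip\<close>

lemma words_map2: "\<lbrakk>hs \<in> words n; gs \<in> words n\<rbrakk> \<Longrightarrow> map2 (monoid.mult H) hs gs \<in> words n"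
  by (fastforce simp: words_def set_zip)

lemma multilinear_map2_right:
  assumes hs: "hs \<in> words n"
  shows "multilinear n (tensor_power n) (\<lambda>gs. tens (map2 (monoid.mult H) hs gs))"
proof -
  have upd: "map2 (monoid.mult H) hs (gs[i := a]) = (map2 (monoid.mult H) hs gs)[i := hs ! i \<otimes>\<^bsub>H\<^esub> a]"
    if "gs \<in> words n" "i < n" for gs i a
    using that hs by (intro nth_equalityI) (auto simp: words_length nth_list_update)
  show ?thesis
    unfolding multilinear_def
  proof (intro conjI ballI allI impI)
    fix gs i a b
    assume *: "gs \<in> words n" "i < n" "a \<in> carrier H" "b \<in> carrier H"
    then show "tens (map2 (monoid.mult H) hs (gs[i := a \<oplus>\<^bsub>H\<^esub> b])) =
      tens (map2 (monoid.mult H) hs (gs[i := a])) \<oplus>\<^bsub>tensor_power n\<^esub> tens (map2 (monoid.mult H) hs (gs[i := b]))"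
      using multilinear_add[OF multilinear_tens words_map2[OF hs *(1)] *(2)] words_nth[OF hs *(2)]
      by (simp add: upd H.r_distr)
  next
    fix gs i j c
    assume *: "gs \<in> words n" "i < n" "j < n" "c \<in> carrier K"
    then show "tens (map2 (monoid.mult H) hs (gs[i := c \<odot>\<^bsub>H\<^esub> gs ! i])) =
      tens (map2 (monoid.mult H) hs (gs[j := c \<odot>\<^bsub>H\<^esub> gs ! j]))"
      using multilinear_smult[OF multilinear_tens words_map2[OF hs *(1)] *(2-4)] words_nth[OF hs]
        words_nth[OF *(1)]
      by (simp add: upd smult_mult_right words_length[OF hs] words_length[OF *(1)])
  qed (intro tens_closed words_map2 hs)
qed

lemma multilinear_map2_left:
  assumes gs: "gs \<in> words n"
  shows "multilinear n (tensor_power n) (\<lambda>hs. tens (map2 (monoid.mult H) hs gs))"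
proof -
  have upd: "map2 (monoid.mult H) (hs[i := a]) gs = (map2 (monoid.mult H) hs gs)[i := a \<otimes>\<^bsub>H\<^esub> gs ! i]"
    if "hs \<in> words n" "i < n" for hs i a
    using that gs by (intro nth_equalityI) (auto simp: words_length nth_list_update)
  show ?thesis
    unfolding multilinear_def
  proof (intro conjI ballI allI impI)
    fix hs i a b
    assume *: "hs \<in> words n" "i < n" "a \<in> carrier H" "b \<in> carrier H"
    then show "tens (map2 (monoid.mult H) (hs[i := a \<oplus>\<^bsub>H\<^esub> b]) gs) =
      tens (map2 (monoid.mult H) (hs[i := a]) gs) \<oplus>\<^bsub>tensor_power n\<^esub> tens (map2 (monoid.mult H) (hs[i := b]) gs)"
      using multilinear_add[OF multilinear_tens words_map2[OF *(1) gs] *(2)] words_nth[OF gs *(2)]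
      by (simp add: upd H.l_distr)
  next
    fix hs i j c
    assume *: "hs \<in> words n" "i < n" "j < n" "c \<in> carrier K"
    then show "tens (map2 (monoid.mult H) (hs[i := c \<odot>\<^bsub>H\<^esub> hs ! i]) gs) =
      tens (map2 (monoid.mult H) (hs[j := c \<odot>\<^bsub>H\<^esub> hs ! j]) gs)"
      using multilinear_smult[OF multilinear_tens words_map2[OF *(1) gs] *(2-4)] words_nth[OF gs]
        words_nth[OF *(1)]
      by (simp add: upd smult_mult_left words_length[OF gs] words_length[OF *(1)])
  qed (intro tens_closed words_map2 gs)
qed

section \<open>The product on a tensor power\<close>

context
  fixes n :: nat
  assumes n: "n > 0"
begin

lemma tens_word_mult_hom:
  assumes "hs \<in> words n"
  shows "tpow_ext n (tensor_power n) (\<lambda>gs. tens (map2 (monoid.mult H) hs gs))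
    \<in> add_hom (tensor_power n) (tensor_power n)"
  using assms by (intro tpow_ext_hom tp.abelian_group_axioms n multilinear_map2_right)

text \<open>The product is an extension in \<open>T\<close> of an extension in \<open>U\<close>, so
  the inner one must be multilinear in the word \<open>hs\<close>. For varying \<open>U\<close> both
  sides are additive, which leaves \<open>U = tens gs\<close>, where
  \<open>multilinear_map2_left\<close> applies.\<close>

lemma multilinear_tpow_mult:
  assumes "U \<in> carrier (tensor_power n)"
  shows "multilinear n (tensor_power n)
    (\<lambda>hs. tpow_ext n (tensor_power n) (\<lambda>gs. tens (map2 (monoid.mult H) hs gs)) U)"
  unfolding multilinear_def
proof (intro conjI ballI allI impI)
  fix hs i a b
  assume *: "hs \<in> words n" "i < n" "a \<in> carrier H" "b \<in> carrier H"
  have w: "hs[i := a \<oplus>\<^bsub>H\<^esub> b] \<in> words n" "hs[i := a] \<in> words n" "hs[i := b] \<in> words n"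
    using * by (auto intro: words_update)
  let ?m = "\<lambda>hs. tpow_ext n (tensor_power n) (\<lambda>gs. tens (map2 (monoid.mult H) hs gs))"
  show "?m (hs[i := a \<oplus>\<^bsub>H\<^esub> b]) U = ?m (hs[i := a]) U \<oplus>\<^bsub>tensor_power n\<^esub> ?m (hs[i := b]) U"
  proof (rule tpow_hom_eqI[OF tp.abelian_group_axioms, where f = "?m (hs[i := a \<oplus>\<^bsub>H\<^esub> b])", OF _ _ _ assms])
    show "(\<lambda>U. ?m (hs[i := a]) U \<oplus>\<^bsub>tensor_power n\<^esub> ?m (hs[i := b]) U)
        \<in> add_hom (tensor_power n) (tensor_power n)"
      by (intro tp.add_hom_plus tens_word_mult_hom w)
    fix gs assume gs: "gs \<in> words n"
    show "?m (hs[i := a \<oplus>\<^bsub>H\<^esub> b]) (tens gs) =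
        ?m (hs[i := a]) (tens gs) \<oplus>\<^bsub>tensor_power n\<^esub> ?m (hs[i := b]) (tens gs)"
      using multilinear_add[OF multilinear_map2_left[OF gs] *] w
      by (simp add: tpow_ext_tens[OF tp.abelian_group_axioms n multilinear_map2_right gs])
  qed (intro tens_word_mult_hom w)
next
  fix hs i j c
  assume *: "hs \<in> words n" "i < n" "j < n" "c \<in> carrier K"
  have w: "hs[i := c \<odot>\<^bsub>H\<^esub> hs ! i] \<in> words n" "hs[j := c \<odot>\<^bsub>H\<^esub> hs ! j] \<in> words n"
    using * by (auto intro!: words_update simp: words_nth)
  let ?m = "\<lambda>hs. tpow_ext n (tensor_power n) (\<lambda>gs. tens (map2 (monoid.mult H) hs gs))"
  show "?m (hs[i := c \<odot>\<^bsub>H\<^esub> hs ! i]) U = ?m (hs[j := c \<odot>\<^bsub>H\<^esub> hs ! j]) U"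
  proof (rule tpow_hom_eqI[OF tp.abelian_group_axioms[of n] _ _ _ assms])
    fix gs assume gs: "gs \<in> words n"
    show "?m (hs[i := c \<odot>\<^bsub>H\<^esub> hs ! i]) (tens gs) = ?m (hs[j := c \<odot>\<^bsub>H\<^esub> hs ! j]) (tens gs)"
      using multilinear_smult[OF multilinear_map2_left[OF gs] *] w
      by (simp add: tpow_ext_tens[OF tp.abelian_group_axioms n multilinear_map2_right gs])
  qed (intro tens_word_mult_hom w)+
qed (intro add_hom_closed[OF tens_word_mult_hom] assms)

lemma tpow_mult_eq:
  "T \<otimes>\<^bsub>tensor_power n\<^esub> U = tpow_ext n (tensor_power n)
    (\<lambda>hs. tpow_ext n (tensor_power n) (\<lambda>gs. tens (map2 (monoid.mult H) hs gs)) U) T"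
  unfolding tensor_power_def[of n, THEN arg_cong[of _ _ monoid.mult]] by simp

lemma tpow_mult_hom_left:
  "U \<in> carrier (tensor_power n) \<Longrightarrow>
    (\<lambda>T. T \<otimes>\<^bsub>tensor_power n\<^esub> U) \<in> add_hom (tensor_power n) (tensor_power n)"
  unfolding tpow_mult_eq
  by (intro tpow_ext_hom tp.abelian_group_axioms n multilinear_tpow_mult)

lemma tens_mult_eq:
  assumes "hs \<in> words n" "U \<in> carrier (tensor_power n)"
  shows "tens hs \<otimes>\<^bsub>tensor_power n\<^esub> U =
    tpow_ext n (tensor_power n) (\<lambda>gs. tens (map2 (monoid.mult H) hs gs)) U"
  unfolding tpow_mult_eq
  by (rule tpow_ext_tens[OF tp.abelian_group_axioms n multilinear_tpow_mult[OF assms(2)] assms(1)])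

lemma tens_mult:
  assumes "hs \<in> words n" "gs \<in> words n"
  shows "tens hs \<otimes>\<^bsub>tensor_power n\<^esub> tens gs = tens (map2 (monoid.mult H) hs gs)"
  using assms
  by (simp add: tens_mult_eq tens_closed tpow_ext_tens[OF tp.abelian_group_axioms n multilinear_map2_right])

lemma tpow_mult_closed:
  "\<lbrakk>T \<in> carrier (tensor_power n); U \<in> carrier (tensor_power n)\<rbrakk> \<Longrightarrow>
    T \<otimes>\<^bsub>tensor_power n\<^esub> U \<in> carrier (tensor_power n)"
  using add_hom_closed[OF tpow_mult_hom_left] .

text \<open>The outer extension gives additivity in the left factor only. Comparing both sides as
  additive maps of \<open>T\<close> leaves \<open>T = tens hs\<close>, where the product is a single
  extension in the right factor.\<close>

lemma tpow_mult_hom_right: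
  assumes "T \<in> carrier (tensor_power n)"
  shows "(\<lambda>U. T \<otimes>\<^bsub>tensor_power n\<^esub> U) \<in> add_hom (tensor_power n) (tensor_power n)"
proof (rule add_homI)
  fix U V assume UV: "U \<in> carrier (tensor_power n)" "V \<in> carrier (tensor_power n)"
  show "T \<otimes>\<^bsub>tensor_power n\<^esub> (U \<oplus>\<^bsub>tensor_power n\<^esub> V) =
      T \<otimes>\<^bsub>tensor_power n\<^esub> U \<oplus>\<^bsub>tensor_power n\<^esub> T \<otimes>\<^bsub>tensor_power n\<^esub> V"
  proof (rule tpow_hom_eqI[OF tp.abelian_group_axioms[of n] _ _ _ assms])
    fix hs assume hs: "hs \<in> words n"
    show "tens hs \<otimes>\<^bsub>tensor_power n\<^esub> (U \<oplus>\<^bsub>tensor_power n\<^esub> V) =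
      tens hs \<otimes>\<^bsub>tensor_power n\<^esub> U \<oplus>\<^bsub>tensor_power n\<^esub> tens hs \<otimes>\<^bsub>tensor_power n\<^esub> V"
      using UV hs by (simp add: tens_mult_eq add_hom_add[OF tens_word_mult_hom])
  qed (intro tp.add_hom_plus tpow_mult_hom_left tp.a_closed UV)+
qed (intro tpow_mult_closed assms)

text \<open>Both sides are additive in each factor, so the identity passes from words to arbitrary
  \<open>V\<close>, then \<open>U\<close>, then \<open>T\<close>. It later makes left multiplication
  commute with the right action of \<open>H\<close>.\<close>

lemma tpow_mult_assoc:
  assumes T: "T \<in> carrier (tensor_power n)" and U: "U \<in> carrier (tensor_power n)"
    and V: "V \<in> carrier (tensor_power n)"
  shows "T \<otimes>\<^bsub>tensor_power n\<^esub> U \<otimes>\<^bsub>tensor_power n\<^esub> V = T \<otimes>\<^bsub>tensor_power n\<^esub> (U \<otimes>\<^bsub>tensor_power n\<^esub> V)"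
proof -
  let ?P = "tensor_power n"
  have 1: "tens hs \<otimes>\<^bsub>?P\<^esub> tens gs \<otimes>\<^bsub>?P\<^esub> tens fs = tens hs \<otimes>\<^bsub>?P\<^esub> (tens gs \<otimes>\<^bsub>?P\<^esub> tens fs)"
    if w: "hs \<in> words n" "gs \<in> words n" "fs \<in> words n" for hs gs fs
  proof -
    have "map2 (monoid.mult H) (map2 (monoid.mult H) hs gs) fs =
        map2 (monoid.mult H) hs (map2 (monoid.mult H) gs fs)"
      using w by (intro nth_equalityI) (auto simp: words_length words_nth H.m_assoc)
    then show ?thesis
      using w by (simp add: tens_mult words_map2)
  qed
  have 2: "tens hs \<otimes>\<^bsub>?P\<^esub> tens gs \<otimes>\<^bsub>?P\<^esub> V = tens hs \<otimes>\<^bsub>?P\<^esub> (tens gs \<otimes>\<^bsub>?P\<^esub> V)"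
    if w: "hs \<in> words n" "gs \<in> words n" for hs gs
    by (rule tpow_hom_eqI[OF tp.abelian_group_axioms[of n] _ _ _ V])
      (use w 1 in \<open>auto intro!: tpow_mult_hom_right add_hom_compose[OF tpow_mult_hom_right tpow_mult_hom_right]
        tpow_mult_closed tens_closed\<close>)
  have 3: "tens hs \<otimes>\<^bsub>?P\<^esub> U \<otimes>\<^bsub>?P\<^esub> V = tens hs \<otimes>\<^bsub>?P\<^esub> (U \<otimes>\<^bsub>?P\<^esub> V)"
    if w: "hs \<in> words n" for hs
    by (rule tpow_hom_eqI[OF tp.abelian_group_axioms[of n] _ _ _ U])
      (use w 2 V in \<open>auto intro!: add_hom_compose[OF tpow_mult_hom_right tpow_mult_hom_left]
        add_hom_compose[OF tpow_mult_hom_left tpow_mult_hom_right] tens_closed\<close>)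
  show ?thesis
    by (rule tpow_hom_eqI[OF tp.abelian_group_axioms[of n] _ _ _ T])
      (use 3 U V in \<open>auto intro!: add_hom_compose[OF tpow_mult_hom_left tpow_mult_hom_left]
        tpow_mult_hom_left tpow_mult_closed\<close>)
qed

end

section \<open>Comultiplication and the exchange of two tensor factors\<close>

lemma comult_closed: "h \<in> carrier H \<Longrightarrow> comult H h \<in> carrier (tensor_power 2)"
  using comult_hom by (auto simp: ring_hom_def)

lemma comult_add: "comult H \<in> add_hom H (tensor_power 2)"
  using comult_hom by (auto simp: ring_hom_def hom_def)

lemma comult_at_closed:
  assumes "i < n" "T \<in> carrier (tensor_power n)"
  shows "comult_at n i T \<in> carrier (tensor_power (Suc n))"
  unfolding comult_at_def
proof (rule tpow_ext_closed[OF tp.abelian_group_axioms _ assms(2)])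
  fix hs assume hs: "hs \<in> words n"
  show "tpow_ext 2 (tensor_power (Suc n)) (\<lambda>gs. tens (take i hs @ gs @ drop (Suc i) hs)) (comult H (hs ! i))
      \<in> carrier (tensor_power (Suc n))"
  proof (rule tpow_ext_closed[OF tp.abelian_group_axioms])
    fix gs assume "gs \<in> words 2"
    then have "take i hs @ gs @ drop (Suc i) hs \<in> words (Suc n)"
      using hs assms(1) by (auto simp: words_def dest: in_set_takeD in_set_dropD)
    then show "tens (take i hs @ gs @ drop (Suc i) hs) \<in> carrier (tensor_power (Suc n))"
      by (rule tens_closed)
  qed (use hs assms in \<open>auto intro: comult_closed words_nth\<close>)
qed (use assms in simp)

lemma iter_comult_closed: "h \<in> carrier H \<Longrightarrow> iter_comult n h \<in> carrier (tensor_power (Suc n))"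
proof (induction n)
  case 0
  then show ?case
    by (auto intro!: tens_closed simp: words_def)
qed (simp add: comult_at_closed)

text \<open>\<open>iter_comult\<close> starts from a one-letter word, so its first step is a doubly
  nested extension that must be identified with \<Delta>.\<close>

lemma iter_comult_1:
  assumes "h \<in> carrier H"
  shows "iter_comult (Suc 0) h = comult H h"
proof -
  \<comment> \<open>Around a one-letter word \<open>take\<close> and \<open>drop\<close> are empty;
    what is extended is \<open>tens\<close> itself, and its extension is the identity.\<close>
  have tens1: "tpow_ext 2 (tensor_power 2) (\<lambda>gs. tens (take 0 hs @ gs @ drop (Suc 0) hs)) T = T"
    if "hs \<in> words 1" "T \<in> carrier (tensor_power 2)" for hs T
  proof (rule tpow_ext_eq[OF tp.abelian_group_axioms _ that(2), where h = "\<lambda>x. x"])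
    show "(\<lambda>x. x) \<in> add_hom (tensor_power 2) (tensor_power 2)"
      by (rule add_homI) simp_all
  qed (use that in \<open>auto elim: words_1E\<close>)
  \<comment> \<open>With one factor the balancing condition compares a word with itself, which
    leaves additivity of \<open>comult H\<close>.\<close>
  have "multilinear 1 (tensor_power 2) (\<lambda>hs. comult H (hs ! 0))"
    unfolding multilinear_def
    by (auto elim!: words_1E simp: comult_closed add_hom_add[OF comult_add] simp del: set_eq_iff)
  then have "tpow_ext 1 (tensor_power 2) (\<lambda>hs. comult H (hs ! 0)) (tens [h]) = comult H h"
    using assms by (subst tpow_ext_tens[OF tp.abelian_group_axioms]) (auto simp: words_def)
  moreover have "tpow_ext 1 (tensor_power 2) (\<lambda>hs. tpow_ext 2 (tensor_power 2)
      (\<lambda>gs. tens (take 0 hs @ gs @ drop (Suc 0) hs)) (comult H (hs ! 0))) (tens [h]) =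
      tpow_ext 1 (tensor_power 2) (\<lambda>hs. comult H (hs ! 0)) (tens [h])"
    using assms
    by (intro tpow_ext_cong tens1 comult_closed tens_closed) (auto simp: words_def dest!: nth_mem[of 0])
  ultimately show ?thesis
    by (simp add: comult_at_def numeral_2_eq_2)
qed

text \<open>Literally the map in the axiom \<open>cocommutative\<close>, so that the axiom reads
  \<open>flip (comult H h) = comult H h\<close>.\<close>

definition flip :: "'h tpow \<Rightarrow> 'h tpow" where
  "flip = tpow_ext 2 (tensor_power 2) (\<lambda>hs. tens [hs ! 1, hs ! 0])"

lemma multilinear_flip: "multilinear 2 (tensor_power 2) (\<lambda>hs. tens [hs ! 1, hs ! 0])"
proof -
  have w: "[a, b] \<in> words 2" if "a \<in> carrier H" "b \<in> carrier H" for a b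
    using that by (auto simp: words_def)
  show ?thesis
    unfolding multilinear_def
  proof (intro conjI ballI allI impI)
    fix hs and i :: nat and a b
    assume *: "hs \<in> words 2" "i < 2" "a \<in> carrier H" "b \<in> carrier H"
    obtain x y where [simp]: "hs = [x, y]" "x \<in> carrier H" "y \<in> carrier H"
      using *(1) by (rule words_2E)
    show "tens [hs[i := a \<oplus>\<^bsub>H\<^esub> b] ! 1, hs[i := a \<oplus>\<^bsub>H\<^esub> b] ! 0] =
        tens [hs[i := a] ! 1, hs[i := a] ! 0] \<oplus>\<^bsub>tensor_power 2\<^esub> tens [hs[i := b] ! 1, hs[i := b] ! 0]"
      \<comment> \<open>Position \<open>i\<close> of \<open>[x, y]\<close> is position
        \<open>1 - i\<close> of the exchanged word \<open>[y, x]\<close>.\<close>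
      using multilinear_add[OF multilinear_tens w[of y x], where i = "1 - i" and a = a and b = b] * less_2_cases[OF *(2)] by auto
  next
    fix hs and i j :: nat and c
    assume *: "hs \<in> words 2" "i < 2" "j < 2" "c \<in> carrier K"
    obtain x y where [simp]: "hs = [x, y]" "x \<in> carrier H" "y \<in> carrier H"
      using *(1) by (rule words_2E)
    show "tens [hs[i := c \<odot>\<^bsub>H\<^esub> hs ! i] ! 1, hs[i := c \<odot>\<^bsub>H\<^esub> hs ! i] ! 0] =
        tens [hs[j := c \<odot>\<^bsub>H\<^esub> hs ! j] ! 1, hs[j := c \<odot>\<^bsub>H\<^esub> hs ! j] ! 0]"
      using multilinear_smult[OF multilinear_tens w[of y x], where i = "1 - i" and j = "1 - j" and c = c] *
        less_2_cases[OF *(2)] less_2_cases[OF *(3)] by auto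
  qed (auto elim!: words_2E intro!: tens_closed w)
qed

lemma flip_hom: "flip \<in> add_hom (tensor_power 2) (tensor_power 2)"
  unfolding flip_def by (intro tpow_ext_hom tp.abelian_group_axioms multilinear_flip) simp

lemma flip_tens: "\<lbrakk>a \<in> carrier H; b \<in> carrier H\<rbrakk> \<Longrightarrow> flip (tens [a, b]) = tens [b, a]"
  unfolding flip_def
  by (subst tpow_ext_tens[OF tp.abelian_group_axioms _ multilinear_flip]) (auto simp: words_def)

text \<open>Words are multiplied factor by factor, so exchanging factors commutes with the product
  there; additivity in \<open>U\<close> and then in \<open>T\<close> gives the rest.\<close>

lemma flip_mult:
  assumes T: "T \<in> carrier (tensor_power 2)" and U: "U \<in> carrier (tensor_power 2)"
  shows "flip (T \<otimes>\<^bsub>tensor_power 2\<^esub> U) = flip T \<otimes>\<^bsub>tensor_power 2\<^esub> flip U"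
proof -
  let ?P = "tensor_power 2"
  have 1: "flip (tens hs \<otimes>\<^bsub>?P\<^esub> tens gs) = flip (tens hs) \<otimes>\<^bsub>?P\<^esub> flip (tens gs)"
    if "hs \<in> words 2" "gs \<in> words 2" for hs gs
    using that by (elim words_2E) (simp add: flip_tens tens_mult words_def)
  have 2: "flip (tens hs \<otimes>\<^bsub>?P\<^esub> U) = flip (tens hs) \<otimes>\<^bsub>?P\<^esub> flip U"
    if w: "hs \<in> words 2" for hs
    by (rule tpow_hom_eqI[OF tp.abelian_group_axioms[of 2] _ _ _ U])
      (use w 1 in \<open>auto intro!: add_hom_compose[OF tpow_mult_hom_right flip_hom]
        add_hom_compose[OF flip_hom tpow_mult_hom_right] add_hom_closed[OF flip_hom] tens_closed\<close>)
  show ?thesis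
    by (rule tpow_hom_eqI[OF tp.abelian_group_axioms[of 2] _ _ _ T])
      (use 2 U in \<open>auto intro!: add_hom_compose[OF tpow_mult_hom_left flip_hom]
        add_hom_compose[OF flip_hom tpow_mult_hom_left] add_hom_closed[OF flip_hom]\<close>)
qed

lemma flip_comult: "h \<in> carrier H \<Longrightarrow> flip (comult H h) = comult H h"
  unfolding flip_def by (rule cocommutative)

text \<open>Brings the right action into the form to which \<open>flip_mult\<close> and
  \<open>flip_comult\<close> apply.\<close>

lemma right_act_2: "h \<in> carrier H \<Longrightarrow> right_act 2 T h = T \<otimes>\<^bsub>tensor_power 2\<^esub> comult H h"
  using iter_comult_1[of h] by (simp add: right_act_def del: iter_comult.simps)

end

section \<open>The groups \<open>H\<^sup>\<otimes>\<^sup>n \<otimes>\<^sub>H M\<close>\<close>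

context hopf_signature
begin

lemma htensor_add_simps [simp]:
  "carrier (htensor_add n M) = carrier (htensor n M)"
  "ring.add (htensor_add n M) = ring.add (htensor n M)"
  "ring.zero (htensor_add n M) = ring.zero (htensor n M)"
  by (simp_all add: htensor_def)

lemma htensor_gens_iff: "(T, x) \<in> htensor_gens n M \<longleftrightarrow> T \<in> carrier (tensor_power n) \<and> x \<in> carrier M"
  by (simp add: htensor_gens_def)

lemma list_sum_htensor_add [simp]: "list_sum (htensor_add n M) = list_sum (htensor n M)"
  by (rule list_sum_cong) simp_all

lemma htensor_ext_htensor_add [simp]:
  "htensor_ext m A (htensor_add n M) = htensor_ext m A (htensor n M)"
  by (rule ext)+ (simp add: htensor_ext_def)

text \<open>The conditions for factoring through
  \<open>H\<^sup>\<otimes>\<^sup>n \<otimes>\<^sub>H M\<close>. The first argument is a whole tensor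
  and not a word, because acting on a word by \<open>h\<close> gives a sum of words.\<close>

definition balanced ::
  "nat \<Rightarrow> ('h, 'm) module \<Rightarrow> ('b, 'c) ring_scheme \<Rightarrow> ('h tpow \<Rightarrow> 'm \<Rightarrow> 'b) \<Rightarrow> bool" where
  "balanced n M G f \<longleftrightarrow>
    (\<forall>x\<in>carrier M. (\<lambda>T. f T x) \<in> add_hom (tensor_power n) G) \<and>
    (\<forall>T\<in>carrier (tensor_power n). f T \<in> add_hom M G) \<and>
    (\<forall>T\<in>carrier (tensor_power n). \<forall>h\<in>carrier H. \<forall>x\<in>carrier M.
      f (right_act n T h) x = f T (h \<odot>\<^bsub>M\<^esub> x))"

end

context cocommutative_hopf_algebra
begin

context
  fixes n :: nat and M :: "('h, 'm) module"
  assumes n: "n > 0" and M: "left_module H M"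
begin

interpretation M: left_module H M
  by (rule M)

lemma right_act_closed:
  "\<lbrakk>T \<in> carrier (tensor_power n); h \<in> carrier H\<rbrakk> \<Longrightarrow> right_act n T h \<in> carrier (tensor_power n)"
  unfolding right_act_def using iter_comult_closed[of h "n - 1"] n by (intro tpow_mult_closed) auto

lemma presentation_htensor: "presentation (htensor_gens n M) (htensor_rels n M)"
proof
  show "htensor_rels n M \<subseteq> carrier (free_Abelian_group (htensor_gens n M))"
    unfolding htensor_rels_def htensor_gens_def
    by (intro Un_least subsetI; elim CollectE exE conjE; hypsubst)
      (intro frag_of_diff_diff_closed frag_of_diff_closed SigmaI tp.a_closed M.M.a_closed M.smult_closed right_act_closed; assumption)+
qed

interpretation ht: presentation "htensor_gens n M" "htensor_rels n M"
  by (rule presentation_htensor)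

lemma abelian_group_htensor: "abelian_group (htensor n M)"
  by (rule abelian_group_cong[OF ht.abelian_group_P]) (simp_all add: htensor_def htensor_add_def)

interpretation HT: abelian_group "htensor n M"
  by (rule abelian_group_htensor)

lemma htensor_eq:
  "carrier (presented (htensor_gens n M) (htensor_rels n M)) = carrier (htensor n M)"
  "ring.add (presented (htensor_gens n M) (htensor_rels n M)) = ring.add (htensor n M)"
  "ring.zero (presented (htensor_gens n M) (htensor_rels n M)) = ring.zero (htensor n M)"
  "a_inv (presented (htensor_gens n M) (htensor_rels n M)) = a_inv (htensor n M)"
  "a_minus (presented (htensor_gens n M) (htensor_rels n M)) = a_minus (htensor n M)"
  by (simp_all add: htensor_def htensor_add_def a_inv_def m_inv_def a_minus_def fun_eq_iff)

lemma htensor_class_closed: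
  "\<lbrakk>T \<in> carrier (tensor_power n); x \<in> carrier M\<rbrakk> \<Longrightarrow> htensor_class n M T x \<in> carrier (htensor n M)"
  using ht.cls_closed[of "(T, x)"] by (simp add: htensor_class_def htensor_eq htensor_gens_iff)

lemma balanced_htensor_class: "balanced n M (htensor n M) (htensor_class n M)"
  unfolding balanced_def
proof (intro conjI ballI add_homI htensor_class_closed)
  fix T U x assume *: "T \<in> carrier (tensor_power n)" "U \<in> carrier (tensor_power n)" "x \<in> carrier M"
  then have "frag_of (T \<oplus>\<^bsub>tensor_power n\<^esub> U, x) - frag_of (T, x) - frag_of (U, x) \<in> htensor_rels n M"
    unfolding htensor_rels_def by blast
  from ht.cls_add_rel[OF this] * show
    "htensor_class n M (T \<oplus>\<^bsub>tensor_power n\<^esub> U) x =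
      htensor_class n M T x \<oplus>\<^bsub>htensor n M\<^esub> htensor_class n M U x"
    by (simp add: htensor_class_def htensor_eq htensor_gens_iff)
next
  fix T x y assume *: "T \<in> carrier (tensor_power n)" "x \<in> carrier M" "y \<in> carrier M"
  then have "frag_of (T, x \<oplus>\<^bsub>M\<^esub> y) - frag_of (T, x) - frag_of (T, y) \<in> htensor_rels n M"
    unfolding htensor_rels_def by blast
  from ht.cls_add_rel[OF this] * show
    "htensor_class n M T (x \<oplus>\<^bsub>M\<^esub> y) = htensor_class n M T x \<oplus>\<^bsub>htensor n M\<^esub> htensor_class n M T y"
    by (simp add: htensor_class_def htensor_eq htensor_gens_iff)
next
  fix T h x assume *: "T \<in> carrier (tensor_power n)" "h \<in> carrier H" "x \<in> carrier M"
  then have "frag_of (right_act n T h, x) - frag_of (T, h \<odot>\<^bsub>M\<^esub> x) \<in> htensor_rels n M"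
    unfolding htensor_rels_def by blast
  from ht.cls_diff_rel[OF this] * show
    "htensor_class n M (right_act n T h) x = htensor_class n M T (h \<odot>\<^bsub>M\<^esub> x)"
    by (simp add: htensor_class_def htensor_gens_iff right_act_closed M.smult_closed)
qed

lemma htensor_class_hom_left:
  "x \<in> carrier M \<Longrightarrow> (\<lambda>T. htensor_class n M T x) \<in> add_hom (tensor_power n) (htensor n M)"
  using balanced_htensor_class by (simp add: balanced_def)

lemma htensor_class_hom_right:
  "T \<in> carrier (tensor_power n) \<Longrightarrow> htensor_class n M T \<in> add_hom M (htensor n M)"
  using balanced_htensor_class by (simp add: balanced_def)

lemma pure_eq: "hs \<in> words n \<Longrightarrow> pure M hs x = htensor_class n M (tens hs) x"
  by (simp add: pure_def words_length)

lemma pure_closed: "\<lbrakk>hs \<in> words n; x \<in> carrier M\<rbrakk> \<Longrightarrow> pure M hs x \<in> carrier (htensor n M)"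
  by (simp add: pure_eq htensor_class_closed tens_closed)

lemma pure_zero: "hs \<in> words n \<Longrightarrow> pure M hs \<zero>\<^bsub>M\<^esub> = \<zero>\<^bsub>htensor n M\<^esub>"
  using add_hom_zero[OF M.abelian_group_axioms HT.abelian_group_axioms htensor_class_hom_right]
  by (simp add: pure_eq tens_closed)

lemma htensor_rep_append:
  assumes "htensor_rep n M v ps" "htensor_rep n M w qs"
  shows "htensor_rep n M (v \<oplus>\<^bsub>htensor n M\<^esub> w) (ps @ qs)"
proof -
  have "set (map (\<lambda>(hs, x). pure M hs x) xs) \<subseteq> carrier (htensor n M)"
    if "set xs \<subseteq> words n \<times> carrier M" for xs
    using that pure_closed by auto
  then show ?thesis
    using assms by (auto simp: htensor_rep_def HT.list_sum_append)
qed

text \<open>Here a sign is absorbed into the module element instead of a factor of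
  \<open>H\<close>.\<close>

lemma htensor_rep_minus:
  assumes "htensor_rep n M w ps"
  shows "htensor_rep n M (\<ominus>\<^bsub>htensor n M\<^esub> w) (map (\<lambda>(hs, x). (hs, \<ominus>\<^bsub>M\<^esub> x)) ps)"
proof -
  have ps: "set ps \<subseteq> words n \<times> carrier M"
    using assms by (simp add: htensor_rep_def)
  have "pure M hs (\<ominus>\<^bsub>M\<^esub> x) = \<ominus>\<^bsub>htensor n M\<^esub> pure M hs x" if "hs \<in> words n" "x \<in> carrier M" for hs x
    using add_hom_minus[OF M.abelian_group_axioms HT.abelian_group_axioms htensor_class_hom_right] that
    by (simp add: pure_eq tens_closed)
  then have "map (\<lambda>(hs, x). pure M hs x) (map (\<lambda>(hs, x). (hs, \<ominus>\<^bsub>M\<^esub> x)) ps) =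
      map (\<lambda>v. \<ominus>\<^bsub>htensor n M\<^esub> v) (map (\<lambda>(hs, x). pure M hs x) ps)"
    using ps by auto
  moreover have "set (map (\<lambda>(hs, x). pure M hs x) ps) \<subseteq> carrier (htensor n M)"
    using ps pure_closed by auto
  moreover have "set (map (\<lambda>(hs, x). (hs, \<ominus>\<^bsub>M\<^esub> x)) ps) \<subseteq> words n \<times> carrier M"
    using ps by auto
  ultimately show ?thesis
    using assms HT.list_sum_minus[of "map (\<lambda>(hs, x). pure M hs x) ps"]
    by (simp only: htensor_rep_def list_sum_htensor_add)
qed

text \<open>The generators of the group involve arbitrary tensors, whereas
  \<open>htensor_rep\<close> allows words only; expanding \<open>T\<close> into words bridges the
  gap.\<close>

lemma htensor_rep_class:
  assumes "T \<in> carrier (tensor_power n)" "x \<in> carrier M"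
  shows "\<exists>ps. htensor_rep n M (htensor_class n M T x) ps"
proof -
  obtain qs where qs: "set qs \<subseteq> words n" "T = list_sum (tensor_power n) (map tens qs)"
    using tpow_rep_exists[OF n assms(1)] by (auto simp: tpow_rep_def)
  have "htensor_class n M T x = list_sum (htensor n M) (map (\<lambda>T. htensor_class n M T x) (map tens qs))"
    using qs tens_closed
    by (subst qs(2), intro add_hom_list_sum[OF tp.abelian_group_axioms HT.abelian_group_axioms]
        htensor_class_hom_left assms(2)) auto
  also have "map (\<lambda>T. htensor_class n M T x) (map tens qs) =
      map (\<lambda>(hs, x). pure M hs x) (map (\<lambda>hs. (hs, x)) qs)"
    using qs(1) by (auto simp: pure_eq)
  finally have "htensor_rep n M (htensor_class n M T x) (map (\<lambda>hs. (hs, x)) qs)"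
    using qs(1) assms(2) by (auto simp: htensor_rep_def)
  then show ?thesis ..
qed

lemma htensor_rep_exists:
  assumes "w \<in> carrier (htensor n M)"
  shows "\<exists>ps. htensor_rep n M w ps"
proof -
  have "w \<in> carrier (presented (htensor_gens n M) (htensor_rels n M))"
    using assms by (simp add: htensor_eq)
  then show ?thesis
  proof (rule ht.span_induct)
    show "\<exists>ps. htensor_rep n M \<zero>\<^bsub>presented (htensor_gens n M) (htensor_rels n M)\<^esub> ps"
      by (intro exI[of _ "[]"]) (simp add: htensor_rep_def htensor_eq)
    show "\<exists>ps. htensor_rep n M (presented_class (htensor_gens n M) (htensor_rels n M) s) ps"
      if "s \<in> htensor_gens n M" for s
      using that htensor_rep_class by (cases s) (simp add: htensor_gens_iff htensor_class_def)
    show "\<exists>ps. htensor_rep n M (a \<ominus>\<^bsub>presented (htensor_gens n M) (htensor_rels n M)\<^esub> b) ps"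
      if "\<exists>ps. htensor_rep n M a ps" "\<exists>ps. htensor_rep n M b ps" for a b
      using that htensor_rep_append[OF _ htensor_rep_minus]
      unfolding htensor_eq a_minus_def by blast
  qed
qed

lemma htensor_rep_some:
  "w \<in> carrier (htensor n M) \<Longrightarrow> htensor_rep n M w (SOME ps. htensor_rep n M w ps)"
  using htensor_rep_exists by (rule someI_ex)

text \<open>As for tensor powers, \<open>f\<close> need not be balanced. This is what places
  composites in the carrier without showing that they are independent of choices.\<close>

lemma htensor_ext_closed:
  assumes "abelian_group G" "w \<in> carrier (htensor n M)"
    and "\<And>hs x. \<lbrakk>hs \<in> words n; x \<in> carrier M\<rbrakk> \<Longrightarrow> f hs x \<in> carrier G"
  shows "htensor_ext n M G f w \<in> carrier G"
  using htensor_rep_some[OF assms(2)] assms(3) unfolding htensor_ext_def htensor_rep_def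
  by (intro abelian_group.list_sum_closed[OF assms(1)]) auto

lemma htensor_ext_eq:
  assumes "abelian_group G" "w \<in> carrier (htensor n M)" "h \<in> add_hom (htensor n M) G"
    and "\<And>hs x. \<lbrakk>hs \<in> words n; x \<in> carrier M\<rbrakk> \<Longrightarrow> h (pure M hs x) = f hs x"
  shows "htensor_ext n M G f w = h w"
proof -
  define ps where "ps = (SOME ps. htensor_rep n M w ps)"
  have ps: "set ps \<subseteq> words n \<times> carrier M"
    "w = list_sum (htensor n M) (map (\<lambda>(hs, x). pure M hs x) ps)"
    using htensor_rep_some[OF assms(2)] by (simp_all add: ps_def htensor_rep_def)
  have "h w = list_sum G (map h (map (\<lambda>(hs, x). pure M hs x) ps))"
    using ps pure_closed by (subst ps(2), intro add_hom_list_sum HT.abelian_group_axioms assms) auto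
  also have "map h (map (\<lambda>(hs, x). pure M hs x) ps) = map (\<lambda>(hs, x). f hs x) ps"
    using ps assms(4) by auto
  finally show ?thesis
    by (simp add: htensor_ext_def ps_def)
qed

text \<open>Both \<open>f\<close> and \<open>g\<close> compute the extension of one and the same
  function, \<open>g\<close> on pure elements, hence agree.\<close>

lemma htensor_hom_eqI:
  assumes "abelian_group G" "f \<in> add_hom (htensor n M) G" "g \<in> add_hom (htensor n M) G"
    and "\<And>T x. \<lbrakk>T \<in> carrier (tensor_power n); x \<in> carrier M\<rbrakk> \<Longrightarrow>
      f (htensor_class n M T x) = g (htensor_class n M T x)"
    and "w \<in> carrier (htensor n M)"
  shows "f w = g w"
proof -
  have "htensor_ext n M G (\<lambda>hs x. g (pure M hs x)) w = f w"
    using assms by (intro htensor_ext_eq) (auto simp: pure_eq tens_closed)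
  moreover have "htensor_ext n M G (\<lambda>hs x. g (pure M hs x)) w = g w"
    using assms by (intro htensor_ext_eq) auto
  ultimately show ?thesis by simp
qed

lemma htensor_universal:
  assumes G: "abelian_group G" and f: "balanced n M G f"
  obtains h where "h \<in> add_hom (htensor n M) G"
    "\<And>T x. \<lbrakk>T \<in> carrier (tensor_power n); x \<in> carrier M\<rbrakk> \<Longrightarrow> h (htensor_class n M T x) = f T x"
proof -
  have fl: "(\<lambda>T. f T x) \<in> add_hom (tensor_power n) G" if "x \<in> carrier M" for x
    using f that by (simp add: balanced_def)
  have fr: "f T \<in> add_hom M G" if "T \<in> carrier (tensor_power n)" for T
    using f that by (simp add: balanced_def)
  obtain h where "h \<in> add_hom (presented (htensor_gens n M) (htensor_rels n M)) G"
    "\<And>s. s \<in> htensor_gens n M \<Longrightarrow>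
      h (presented_class (htensor_gens n M) (htensor_rels n M) s) = case_prod f s"
  proof (rule ht.universal[OF G, of "case_prod f"])
    show "case_prod f s \<in> carrier G" if "s \<in> htensor_gens n M" for s
      using that add_hom_closed[OF fr] by (cases s) (simp add: htensor_gens_iff)
    fix r h
    assume h: "h \<in> hom (free_Abelian_group (htensor_gens n M)) (add_monoid G)"
      and hf: "\<And>s. s \<in> htensor_gens n M \<Longrightarrow> h (frag_of s) = case_prod f s"
    assume "r \<in> htensor_rels n M"
    then show "h r = \<zero>\<^bsub>G\<^esub>"
      unfolding htensor_rels_def
    proof (elim UnE CollectE exE conjE)
      fix T U x
      assume r: "r = frag_of (T \<oplus>\<^bsub>tensor_power n\<^esub> U, x) - frag_of (T, x) - frag_of (U, x)"
        and *: "T \<in> carrier (tensor_power n)" "U \<in> carrier (tensor_power n)" "x \<in> carrier M"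
      show ?thesis
        unfolding r using * add_hom_add[OF fl[OF *(3)] *(1,2)]
        by (intro ht.hom_add_rel[OF G h]) (simp_all add: hf htensor_gens_iff)
    next
      fix T x y
      assume r: "r = frag_of (T, x \<oplus>\<^bsub>M\<^esub> y) - frag_of (T, x) - frag_of (T, y)"
        and *: "T \<in> carrier (tensor_power n)" "x \<in> carrier M" "y \<in> carrier M"
      show ?thesis
        unfolding r using * add_hom_add[OF fr[OF *(1)] *(2,3)]
        by (intro ht.hom_add_rel[OF G h]) (simp_all add: hf htensor_gens_iff)
    next
      fix T h' x
      assume r: "r = frag_of (right_act n T h', x) - frag_of (T, h' \<odot>\<^bsub>M\<^esub> x)"
        and *: "T \<in> carrier (tensor_power n)" "h' \<in> carrier H" "x \<in> carrier M"
      show ?thesis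
        unfolding r using * f
        by (intro ht.hom_diff_rel[OF G h])
          (simp_all add: hf htensor_gens_iff balanced_def right_act_closed M.smult_closed)
    qed
  qed blast
  then show thesis
    using that by (simp add: htensor_class_def htensor_eq hom_def htensor_gens_iff)
qed

text \<open>The extension is specified by \<open>f\<close> on words, but balancedness can only be
  stated for a function \<open>F\<close> of tensors; agreement of the two on words makes the chosen
  sum well defined.\<close>

lemma htensor_ext_balanced:
  assumes G: "abelian_group G" and F: "balanced n M G F"
    and f: "\<And>hs x. \<lbrakk>hs \<in> words n; x \<in> carrier M\<rbrakk> \<Longrightarrow> f hs x = F (tens hs) x"
  shows "htensor_ext n M G f \<in> add_hom (htensor n M) G"
    and "\<lbrakk>T \<in> carrier (tensor_power n); x \<in> carrier M\<rbrakk> \<Longrightarrow>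
      htensor_ext n M G f (htensor_class n M T x) = F T x"
proof -
  obtain h where h: "h \<in> add_hom (htensor n M) G"
    "\<And>T x. \<lbrakk>T \<in> carrier (tensor_power n); x \<in> carrier M\<rbrakk> \<Longrightarrow> h (htensor_class n M T x) = F T x"
    using htensor_universal[OF G F] by blast
  have eq: "htensor_ext n M G f w = h w" if "w \<in> carrier (htensor n M)" for w
    using f h by (intro htensor_ext_eq G that) (auto simp: pure_eq tens_closed)
  then show "htensor_ext n M G f \<in> add_hom (htensor n M) G"
    using h(1) by (intro add_homI) (auto simp: add_hom_closed add_hom_add)
  show "htensor_ext n M G f (htensor_class n M T x) = F T x"
    if "T \<in> carrier (tensor_power n)" "x \<in> carrier M"
    using eq h(2) that htensor_class_closed by simp
qed

section \<open>The left action of the tensor power\<close>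

lemma htensor_smult_eq:
  "T \<odot>\<^bsub>htensor n M\<^esub> w =
    htensor_ext n M (htensor n M) (\<lambda>hs x. htensor_class n M (T \<otimes>\<^bsub>tensor_power n\<^esub> tens hs) x) w"
  unfolding htensor_def[of n M, THEN arg_cong[of _ _ smult]] by simp

text \<open>Left multiplication by \<open>T\<close> commutes with the right action of
  \<open>H\<close> by associativity, hence descends to the tensor product over
  \<open>H\<close>.\<close>

lemma
  assumes T: "T \<in> carrier (tensor_power n)"
  shows htensor_smult_hom: "(\<lambda>w. T \<odot>\<^bsub>htensor n M\<^esub> w) \<in> add_hom (htensor n M) (htensor n M)"
    and htensor_smult_class: "\<lbrakk>U \<in> carrier (tensor_power n); x \<in> carrier M\<rbrakk> \<Longrightarrow>
      T \<odot>\<^bsub>htensor n M\<^esub> htensor_class n M U x = htensor_class n M (T \<otimes>\<^bsub>tensor_power n\<^esub> U) x"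
proof -
  have right_act_mult: "right_act n (T \<otimes>\<^bsub>tensor_power n\<^esub> U) h = T \<otimes>\<^bsub>tensor_power n\<^esub> right_act n U h"
    if "U \<in> carrier (tensor_power n)" "h \<in> carrier H" for U h
    unfolding right_act_def using iter_comult_closed[OF that(2), of "n - 1"] n that T
    by (intro tpow_mult_assoc) auto
  then have F: "balanced n M (htensor n M) (\<lambda>U. htensor_class n M (T \<otimes>\<^bsub>tensor_power n\<^esub> U))"
    using balanced_htensor_class tpow_mult_closed[OF n T] unfolding balanced_def
    by (intro conjI ballI add_hom_compose[OF tpow_mult_hom_right[OF n T] htensor_class_hom_left]
        htensor_class_hom_right) (simp_all flip: right_act_mult)
  show "(\<lambda>w. T \<odot>\<^bsub>htensor n M\<^esub> w) \<in> add_hom (htensor n M) (htensor n M)"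
    unfolding htensor_smult_eq
    using htensor_ext_balanced(1)[OF abelian_group_htensor F] by (simp add: eta_contract_eq)
  show "T \<odot>\<^bsub>htensor n M\<^esub> htensor_class n M U x = htensor_class n M (T \<otimes>\<^bsub>tensor_power n\<^esub> U) x"
    if "U \<in> carrier (tensor_power n)" "x \<in> carrier M"
    unfolding htensor_smult_eq
    using htensor_ext_balanced(2)[OF abelian_group_htensor F _ that] by simp
qed

end

section \<open>The exchange of two slots over a module\<close>

context
  fixes M :: "('h, 'm) module"
  assumes M: "left_module H M"
begin

lemma
  shows slots_flip_hom: "slots M [1, 0] \<in> add_hom (htensor 2 M) (htensor 2 M)"
    and slots_flip_class: "\<lbrakk>T \<in> carrier (tensor_power 2); x \<in> carrier M\<rbrakk> \<Longrightarrow>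
      slots M [1, 0] (htensor_class 2 M T x) = htensor_class 2 M (flip T) x"
proof -
  have two: "length [1, 0 :: nat] = 2" "(2::nat) > 0"
    by simp_all
  note cls = balanced_htensor_class[OF two(2) M]
  \<comment> \<open>the only use of cocommutativity\<close>
  have "flip (right_act 2 T h) = right_act 2 (flip T) h"
    if "T \<in> carrier (tensor_power 2)" "h \<in> carrier H" for T h
    using that using add_hom_closed[OF flip_hom] by (simp add: right_act_2 flip_mult comult_closed flip_comult)
  then have F: "balanced 2 M (htensor 2 M) (\<lambda>T. htensor_class 2 M (flip T))"
    using cls add_hom_closed[OF flip_hom] unfolding balanced_def
    by (auto intro!: add_hom_compose[OF flip_hom htensor_class_hom_left[OF two(2) M]])
  \<comment> \<open>Sorting by the keys 1, 0 reverses a two-letter word, so the slot rearrangement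
    is the map induced by \<open>flip\<close>.\<close>
  have f: "pure M (map snd (sort_key fst (zip [1, 0 :: nat] hs))) x = htensor_class 2 M (flip (tens hs)) x"
    if hs: "hs \<in> words 2" for hs x
  proof -
    obtain a b where "hs = [a, b]" "a \<in> carrier H" "b \<in> carrier H"
      using hs by (rule words_2E)
    then show ?thesis
      by (simp add: flip_tens pure_def flip: numeral_2_eq_2)
  qed
  show "slots M [1, 0] \<in> add_hom (htensor 2 M) (htensor 2 M)"
    unfolding slots_def two
    by (intro htensor_ext_balanced(1)[OF two(2) M abelian_group_htensor[OF two(2) M] F] f)
  show "slots M [1, 0] (htensor_class 2 M T x) = htensor_class 2 M (flip T) x"
    if "T \<in> carrier (tensor_power 2)" "x \<in> carrier M"
    unfolding slots_def two
    by (intro htensor_ext_balanced(2)[OF two(2) M abelian_group_htensor[OF two(2) M] F] f that)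
qed

text \<open>On a class this is \<open>flip_mult\<close> with
  \<open>flip (tens [g, h]) = tens [h, g]\<close>; both sides are additive in
  \<open>w\<close>.\<close>

lemma slots_flip_smult:
  assumes g: "g \<in> carrier H" and h: "h \<in> carrier H" and w: "w \<in> carrier (htensor 2 M)"
  shows "slots M [1, 0] (tens [g, h] \<odot>\<^bsub>htensor 2 M\<^esub> w) = tens [h, g] \<odot>\<^bsub>htensor 2 M\<^esub> slots M [1, 0] w"
proof -
  have two: "(2::nat) > 0" by simp
  have gh: "tens [g, h] \<in> carrier (tensor_power 2)" "tens [h, g] \<in> carrier (tensor_power 2)"
    using g h by (auto intro!: tens_closed simp: words_def)
  show ?thesis
  proof (rule htensor_hom_eqI[OF two M abelian_group_htensor[OF two M] _ _ _ w])
    show "(\<lambda>w. slots M [1, 0] (tens [g, h] \<odot>\<^bsub>htensor 2 M\<^esub> w)) \<in> add_hom (htensor 2 M) (htensor 2 M)"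
      by (rule add_hom_compose[OF htensor_smult_hom[OF two M gh(1)] slots_flip_hom])
    show "(\<lambda>w. tens [h, g] \<odot>\<^bsub>htensor 2 M\<^esub> slots M [1, 0] w) \<in> add_hom (htensor 2 M) (htensor 2 M)"
      by (rule add_hom_compose[OF slots_flip_hom htensor_smult_hom[OF two M gh(2)]])
    fix T x assume "T \<in> carrier (tensor_power 2)" "x \<in> carrier M"
    then show "slots M [1, 0] (tens [g, h] \<odot>\<^bsub>htensor 2 M\<^esub> htensor_class 2 M T x) =
        tens [h, g] \<odot>\<^bsub>htensor 2 M\<^esub> slots M [1, 0] (htensor_class 2 M T x)"
      using gh g h add_hom_closed[OF flip_hom]
      by (simp add: htensor_smult_class[OF two M] slots_flip_class tpow_mult_closed flip_mult flip_tens
          del: One_nat_def)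
  qed
qed

end

end

section \<open>Composition and the coboundary of a 3-cochain\<close>

text \<open>Translates between the shape of (iii) and (iv) with vanishing right side and the shape
  of the Jacobi and representation identities.\<close>

lemma (in abelian_group) diff_plus_eq_zero_iff:
  assumes "a \<in> carrier G" "b \<in> carrier G" "c \<in> carrier G"
  shows "a \<ominus> b \<oplus> c = \<zero> \<longleftrightarrow> a = b \<ominus> c"
proof -
  have "a \<ominus> b \<oplus> c = a \<ominus> (b \<ominus> c)"
    using assms by (simp add: a_minus_def minus_add minus_minus a_assoc)
  then show ?thesis
    using minus_eq_zero_iff assms by simp
qed

text \<open>The sign bookkeeping of a coboundary in degree 3, with opaque terms. The sums run over
  \<open>j\<close> and then \<open>i < j\<close>; the result lists the pairs in the order used in
  (v).\<close>

lemma (in abelian_group) finsum_pairs_upto_3: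
  fixes t :: "nat \<Rightarrow> 'a" and s :: "nat \<Rightarrow> nat \<Rightarrow> 'a"
  assumes "t 0 = a0" "t 1 = \<ominus> a1" "t 2 = a2" "t 3 = \<ominus> a3"
    and "s 0 1 = \<ominus> b01" "s 0 2 = b02" "s 0 3 = \<ominus> b03" "s 1 2 = \<ominus> b12" "s 1 3 = b13" "s 2 3 = \<ominus> b23"
    and "a0 \<in> carrier G" "a1 \<in> carrier G" "a2 \<in> carrier G" "a3 \<in> carrier G"
      "b01 \<in> carrier G" "b02 \<in> carrier G" "b03 \<in> carrier G" "b12 \<in> carrier G" "b13 \<in> carrier G"
      "b23 \<in> carrier G"
  shows "(\<Oplus>i\<in>{..3}. t i) \<oplus> (\<Oplus>j\<in>{..3}. \<Oplus>i\<in>{..<j}. s i j) =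
    a0 \<ominus> a1 \<oplus> a2 \<ominus> a3 \<ominus> b01 \<oplus> b02 \<ominus> b03 \<ominus> b12 \<oplus> b13 \<ominus> b23"
proof -
  have sets: "{..3::nat} = {0, 1, 2, 3}" "{..<0::nat} = {}" "{..<1::nat} = {0}" "{..<2::nat} = {0, 1}"
    "{..<3::nat} = {0, 1, 2}"
    by auto
  have inner: "(\<Oplus>i\<in>{..<0}. s i 0) = \<zero>" "(\<Oplus>i\<in>{..<1}. s i 1) = \<ominus> b01"
    "(\<Oplus>i\<in>{..<2}. s i 2) = b02 \<oplus> \<ominus> b12" "(\<Oplus>i\<in>{..<3}. s i 3) = \<ominus> b03 \<oplus> (b13 \<oplus> \<ominus> b23)"
    unfolding sets using assms by (simp_all del: One_nat_def)
  show ?thesis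
    unfolding sets(1) using assms inner by (simp add: a_minus_def a_ac del: One_nat_def)
qed

section \<open>Closure of rearrangements and composites\<close>

context cocommutative_hopf_algebra
begin

lemma slots_closed:
  assumes M: "left_module H M" and n: "n > 0" and s: "length s = n" and w: "w \<in> carrier (htensor n M)"
  shows "slots M s w \<in> carrier (htensor n M)"
proof -
  have "map snd (sort_key fst (zip s hs)) \<in> words n" if "hs \<in> words n" for hs
    using that s by (auto simp: words_def dest!: set_zip_rightD)
  then show ?thesis
    unfolding slots_def s
    by (intro htensor_ext_closed[OF n M abelian_group_htensor[OF n M] w] pure_closed[OF n M])
qed

text \<open>\<open>coboundary\<close> applies \<open>slots\<close> to every term, also to those
  whose arguments already stand in the fixed order, while (v) leaves these bare.\<close>

lemma slots_id:
  assumes M: "left_module H M" and n: "n > 0" and w: "w \<in> carrier (htensor n M)"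
  shows "slots M [0..<n] w = w"
proof -
  have "htensor_ext n M (htensor n M) (\<lambda>hs x. pure M (map snd (sort_key fst (zip [0..<n] hs))) x) w = w"
  proof (rule htensor_ext_eq[OF n M abelian_group_htensor[OF n M] w])
    show "(\<lambda>w. w) \<in> add_hom (htensor n M) (htensor n M)"
      by (rule add_homI) simp_all
    fix hs x assume "hs \<in> words n"
    then show "pure M hs x = pure M (map snd (sort_key fst (zip [0..<n] hs))) x"
      by (simp add: sort_key_id_if_sorted words_length)
  qed
  then show ?thesis
    by (simp add: slots_def)
qed

text \<open>All three nested extensions are sums of pure elements, whatever expressions are chosen,
  so \<open>\<Phi>\<close> only has to take values in the carrier. \<open>N\<close> is a separate
  variable so that goals with a numeral exponent match.\<close>

lemma insert_at_closed:
  assumes A: "left_module H A" and B: "left_module H B" and l: "l > 0" and m: "m < k"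
    and N: "N = k + l - 1" and w: "w \<in> carrier (htensor l A)"
    and \<Phi>: "\<And>e. e \<in> carrier A \<Longrightarrow> \<Phi> e \<in> carrier (htensor k B)"
  shows "insert_at B k m \<Phi> A l w \<in> carrier (htensor N B)"
proof -
  have k: "k > 0" and N0: "N > 0"
    using m l N by auto
  note Q = abelian_group_htensor[OF N0 B]
  show ?thesis
    unfolding insert_at_def Let_def N[symmetric]
  proof (intro htensor_ext_closed[OF l A Q w] htensor_ext_closed[OF k B Q \<Phi>] tpow_ext_closed[OF Q l]
      pure_closed[OF N0 B])
    fix hs fs gs
    assume "hs \<in> words l" "fs \<in> words k" "gs \<in> words l"
    then show "take m fs @ map2 (monoid.mult H) hs gs @ drop (Suc m) fs \<in> words N"
      \<comment> \<open>The length is \<open>m + l + (k - Suc m)\<close>, which equals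
        \<open>k + l - 1\<close> since \<open>m < k\<close>.\<close>
      using words_map2[of hs l gs] m l N by (auto simp: words_def dest: in_set_takeD in_set_dropD)
  next
    fix fs assume "fs \<in> words k"
    then show "iter_comult (l - 1) (fs ! m) \<in> carrier (tensor_power l)"
      using iter_comult_closed[OF words_nth[OF _ m], of fs "l - 1"] l by simp
  qed
qed

lemma ins_left_closed:
  assumes "left_module H A" "left_module H B" "l > 0" "w \<in> carrier (htensor l A)"
    and "\<And>e. e \<in> carrier A \<Longrightarrow> \<phi> (e, z) \<in> carrier (htensor 2 B)" "N = Suc l"
  shows "ins_left B \<phi> A l w z \<in> carrier (htensor N B)"
  unfolding ins_left_def using assms by (intro insert_at_closed) auto

lemma ins_right_closed:
  assumes "left_module H A" "left_module H B" "l > 0" "w \<in> carrier (htensor l A)"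
    and "\<And>e. e \<in> carrier A \<Longrightarrow> \<phi> (x, e) \<in> carrier (htensor 2 B)" "N = Suc l"
  shows "ins_right B \<phi> x A l w \<in> carrier (htensor N B)"
  unfolding ins_right_def using assms by (intro insert_at_closed) auto

lemma polylinear2_closed:
  "\<lbrakk>\<phi> \<in> polylinear2 A B C; x \<in> carrier A; y \<in> carrier B\<rbrakk> \<Longrightarrow> \<phi> (x, y) \<in> carrier (htensor 2 C)"
  by (auto simp: polylinear2_def)

lemma polylinear2_hom_left:
  "\<lbrakk>\<phi> \<in> polylinear2 A B C; y \<in> carrier B\<rbrakk> \<Longrightarrow> (\<lambda>x. \<phi> (x, y)) \<in> add_hom A (htensor 2 C)"
  by (intro add_homI) (auto simp: polylinear2_def)

lemma polylinear2_hom_right: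
  "\<lbrakk>\<phi> \<in> polylinear2 A B C; x \<in> carrier A\<rbrakk> \<Longrightarrow> (\<lambda>y. \<phi> (x, y)) \<in> add_hom B (htensor 2 C)"
  by (intro add_homI) (auto simp: polylinear2_def)

lemma cochains_3_closed:
  "\<lbrakk>\<theta> \<in> cochains 3 L M; x \<in> carrier L; y \<in> carrier L; z \<in> carrier L\<rbrakk> \<Longrightarrow>
    \<theta> [x, y, z] \<in> carrier (htensor 3 M)"
  by (auto simp: cochains_def polylinear_def arguments_def)

lemma polylinear_add:
  "\<lbrakk>\<phi> \<in> polylinear n L M; xs \<in> arguments n L; i < n; x \<in> carrier L; y \<in> carrier L\<rbrakk> \<Longrightarrow>
    \<phi> (xs[i := x \<oplus>\<^bsub>L\<^esub> y]) = \<phi> (xs[i := x]) \<oplus>\<^bsub>htensor n M\<^esub> \<phi> (xs[i := y])"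
  by (simp add: polylinear_def)

text \<open>Makes \<open>\<theta> [x, y, \<zero>]\<close> vanish, which is the right side of (iv)
  when \<open>\<beta>\<^sub>1 = 0\<close>.\<close>

lemma cochains_3_hom_last:
  assumes \<theta>: "\<theta> \<in> cochains 3 L M" and x: "x \<in> carrier L" and y: "y \<in> carrier L"
  shows "(\<lambda>z. \<theta> [x, y, z]) \<in> add_hom L (htensor 3 M)"
proof (rule add_homI)
  fix z z' assume z: "z \<in> carrier L" "z' \<in> carrier L"
  then have "[x, y, z] \<in> arguments 3 L"
    using x y by (auto simp: arguments_def)
  from polylinear_add[OF _ this _ z, of \<theta> M 2] \<theta> have "\<theta> ([x, y, z][2 := z \<oplus>\<^bsub>L\<^esub> z']) =
      \<theta> ([x, y, z][2 := z]) \<oplus>\<^bsub>htensor 3 M\<^esub> \<theta> ([x, y, z][2 := z'])"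
    by (simp add: cochains_def)
  then show "\<theta> [x, y, z \<oplus>\<^bsub>L\<^esub> z'] = \<theta> [x, y, z] \<oplus>\<^bsub>htensor 3 M\<^esub> \<theta> [x, y, z']"
    by (simp add: numeral_2_eq_2)
qed (use cochains_3_closed[OF \<theta> x y] in simp)

text \<open>The right side repeats the left side of (v) term by term, order and association
  included, so that the two conditions can be matched without rearranging.\<close>

lemma coboundary_3:
  assumes L: "left_module H L" and M: "left_module H M"
    and br: "br \<in> polylinear2 L L L" and act: "act \<in> polylinear2 L M M" and \<theta>: "\<theta> \<in> cochains 3 L M"
    and xs: "x \<in> carrier L" "y \<in> carrier L" "z \<in> carrier L" "w \<in> carrier L"
  shows "coboundary L br M act 3 \<theta> [x, y, z, w] =
    ins_right M act x M 3 (\<theta> [y, z, w])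
      \<ominus>\<^bsub>htensor 4 M\<^esub> slots M [1, 0, 2, 3] (ins_right M act y M 3 (\<theta> [x, z, w]))
      \<oplus>\<^bsub>htensor 4 M\<^esub> slots M [2, 0, 1, 3] (ins_right M act z M 3 (\<theta> [x, y, w]))
      \<ominus>\<^bsub>htensor 4 M\<^esub> slots M [3, 0, 1, 2] (ins_right M act w M 3 (\<theta> [x, y, z]))
      \<ominus>\<^bsub>htensor 4 M\<^esub> insert_at M 3 0 (\<lambda>e. \<theta> [e, z, w]) L 2 (br (x, y))
      \<oplus>\<^bsub>htensor 4 M\<^esub> slots M [0, 2, 1, 3] (insert_at M 3 0 (\<lambda>e. \<theta> [e, y, w]) L 2 (br (x, z)))
      \<ominus>\<^bsub>htensor 4 M\<^esub> slots M [0, 3, 1, 2] (insert_at M 3 0 (\<lambda>e. \<theta> [e, y, z]) L 2 (br (x, w)))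
      \<ominus>\<^bsub>htensor 4 M\<^esub> slots M [1, 2, 0, 3] (insert_at M 3 0 (\<lambda>e. \<theta> [e, x, w]) L 2 (br (y, z)))
      \<oplus>\<^bsub>htensor 4 M\<^esub> slots M [1, 3, 0, 2] (insert_at M 3 0 (\<lambda>e. \<theta> [e, x, z]) L 2 (br (y, w)))
      \<ominus>\<^bsub>htensor 4 M\<^esub> slots M [2, 3, 0, 1] (insert_at M 3 0 (\<lambda>e. \<theta> [e, x, y]) L 2 (br (z, w)))"
proof -
  have act_closed: "ins_right M act a M 3 v \<in> carrier (htensor 4 M)"
    if "a \<in> carrier L" "v \<in> carrier (htensor 3 M)" for a v
    using that polylinear2_closed[OF act] by (intro ins_right_closed M) auto
  have br_closed: "insert_at M 3 0 (\<lambda>e. \<theta> [e, a, b]) L 2 (br (c, d)) \<in> carrier (htensor 4 M)"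
    if "a \<in> carrier L" "b \<in> carrier L" "c \<in> carrier L" "d \<in> carrier L" for a b c d
    using that polylinear2_closed[OF br] cochains_3_closed[OF \<theta>] by (intro insert_at_closed L M) auto
  have slots_4: "slots M s v \<in> carrier (htensor 4 M)"
    if "length s = 4" "v \<in> carrier (htensor 4 M)" for s v
    using that by (intro slots_closed M) simp_all
  have upt: "[0..<4] = [0, 1, 2, 3]"
    by (simp add: upt_rec)
  have slots_id_4: "slots M [0, 1, 2, 3] v = v" if "v \<in> carrier (htensor 4 M)" for v
    using slots_id[OF M _ that] by (simp add: upt del: One_nat_def)
  \<comment> \<open>The index sets are complements of one or two indices; in this form membership is
    decided index by index.\<close>
  have nths4: "nths [a, b, c, d] S = (if 0 \<in> S then [a] else []) @ (if 1 \<in> S then [b] else []) @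
      (if 2 \<in> S then [c] else []) @ (if 3 \<in> S then [d] else [])" for a b c d :: "'x" and S
    by (simp add: nths_Cons numeral_2_eq_2 numeral_3_eq_3)
  note closed = act_closed br_closed slots_4 cochains_3_closed[OF \<theta>] xs
  have "htensor (Suc 3) M = htensor 4 M"
    by simp
  then show ?thesis
    unfolding coboundary_def Let_def
    \<comment> \<open>Matching the goal instantiates the ten terms, leaving their signs and
      memberships. \<open>slots_id_4\<close> serves the two terms already in order,
      \<open>i = 0\<close> and \<open>(i, j) = (0, 1)\<close>.\<close>
    by (simp only:, intro abelian_group.finsum_pairs_upto_3[OF abelian_group_htensor[OF _ M]])
      (simp_all add: nths4 upt signed_def slots_id_4 closed del: One_nat_def)
qed

end

section \<open>Skeletal pseudoalgebras\<close>

lemma (in left_module) smult_zero: "a \<in> carrier R \<Longrightarrow> a \<odot>\<^bsub>M\<^esub> \<zero>\<^bsub>M\<^esub> = \<zero>\<^bsub>M\<^esub>"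
  by (rule add_hom_zero[OF M.abelian_group_axioms M.abelian_group_axioms, of "\<lambda>x. a \<odot>\<^bsub>M\<^esub> x"])
    (simp add: add_homI smult_closed smult_r_distr)

context cocommutative_hopf_algebra
begin

text \<open>Each summand is \<open>pure B hs \<zero>\<close>, which is zero, so the sum agrees with
  the zero homomorphism.\<close>

lemma push_zero:
  assumes A: "left_module H A" and B: "left_module H B" and n: "n > 0"
    and w: "w \<in> carrier (htensor n A)" and b: "\<And>x. x \<in> carrier A \<Longrightarrow> b x = \<zero>\<^bsub>B\<^esub>"
  shows "push n A B b w = \<zero>\<^bsub>htensor n B\<^esub>"
proof -
  interpret Q: abelian_group "htensor n B"
    by (rule abelian_group_htensor[OF n B])
  show ?thesis
    unfolding push_def
  proof (rule htensor_ext_eq[OF n A Q.abelian_group_axioms w])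
    show "(\<lambda>_. \<zero>\<^bsub>htensor n B\<^esub>) \<in> add_hom (htensor n A) (htensor n B)"
      by (rule add_homI) simp_all
  qed (simp add: b pure_zero[OF n B])
qed

text \<open>Restricted to the carriers because the members of \<open>polylinear2\<close> are
  \<open>undefined\<close> elsewhere; otherwise \<open>beta2_10\<close> could not be recovered as a
  function.\<close>

definition opposite_action ::
  "('h, 'l) module \<Rightarrow> ('h, 'm) module \<Rightarrow> ('l \<times> 'm \<Rightarrow> ('h, 'm) htens) \<Rightarrow> 'm \<times> 'l \<Rightarrow> ('h, 'm) htens" where
  "opposite_action L M act =
    (\<lambda>(u, x)\<in>carrier M \<times> carrier L. \<ominus>\<^bsub>htensor 2 M\<^esub> slots M [1, 0] (act (x, u)))"

lemma opposite_action_polylinear2: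
  assumes L: "left_module H L" and M: "left_module H M" and act: "act \<in> polylinear2 L M M"
  shows "opposite_action L M act \<in> polylinear2 M L M"
proof -
  interpret L: left_module H L by fact
  interpret M: left_module H M by fact
  have two: "(2::nat) > 0" by simp
  interpret Q: abelian_group "htensor 2 M"
    by (rule abelian_group_htensor[OF two M])
  let ?\<sigma> = "slots M [1, 0]"
  have neg: "(\<lambda>v. \<ominus>\<^bsub>htensor 2 M\<^esub> v) \<in> add_hom (htensor 2 M) (htensor 2 M)"
    by (rule add_homI) (simp_all add: Q.minus_add)
  have \<sigma>: "(\<lambda>v. \<ominus>\<^bsub>htensor 2 M\<^esub> ?\<sigma> v) \<in> add_hom (htensor 2 M) (htensor 2 M)"
    by (rule add_hom_compose[OF slots_flip_hom[OF M] neg])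
  have closed: "act (x, u) \<in> carrier (htensor 2 M)" if "x \<in> carrier L" "u \<in> carrier M" for x u
    using polylinear2_closed[OF act that] .
  \<comment> \<open>The action receives the scalars in the order \<open>h, g\<close>, and the
    exchange of slots puts them back into the order \<open>g, h\<close> of the arguments
    \<open>u, x\<close>.\<close>
  have smult: "\<ominus>\<^bsub>htensor 2 M\<^esub> ?\<sigma> (act (h \<odot>\<^bsub>L\<^esub> x, g \<odot>\<^bsub>M\<^esub> u)) =
      tens [g, h] \<odot>\<^bsub>htensor 2 M\<^esub> (\<ominus>\<^bsub>htensor 2 M\<^esub> ?\<sigma> (act (x, u)))"
    if "g \<in> carrier H" "h \<in> carrier H" "x \<in> carrier L" "u \<in> carrier M" for g h x u
  proof -
    have "act (h \<odot>\<^bsub>L\<^esub> x, g \<odot>\<^bsub>M\<^esub> u) = tens [h, g] \<odot>\<^bsub>htensor 2 M\<^esub> act (x, u)"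
      using act that by (simp add: polylinear2_def)
    moreover have "tens [g, h] \<in> carrier (tensor_power 2)"
      using that by (auto intro!: tens_closed simp: words_def)
    ultimately show ?thesis
      using that closed[OF that(3,4)] add_hom_closed[OF slots_flip_hom[OF M] closed[OF that(3,4)]]
        add_hom_minus[OF Q.abelian_group_axioms Q.abelian_group_axioms htensor_smult_hom[OF two M]]
      by (simp add: slots_flip_smult[OF M] del: One_nat_def)
  qed
  show ?thesis
    unfolding polylinear2_def opposite_action_def
    using closed add_hom_closed[OF \<sigma>] smult
      add_hom_add[OF add_hom_compose[OF polylinear2_hom_left[OF act] \<sigma>]]
      add_hom_add[OF add_hom_compose[OF polylinear2_hom_right[OF act] \<sigma>]]
    by (intro CollectI conjI ballI)
      (simp_all add: L.smult_closed M.smult_closed Pi_iff split_beta mem_Times_iff del: One_nat_def)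
qed

section \<open>Comparison of the two systems of axioms\<close>

lemma arguments_4E:
  assumes "xs \<in> arguments 4 L"
  obtains x y z w where "xs = [x, y, z, w]"
    "x \<in> carrier L" "y \<in> carrier L" "z \<in> carrier L" "w \<in> carrier L"
  using assms by (auto simp: arguments_def eval_nat_numeral length_Suc_conv)

lemma cocycle_3_iff:
  assumes L: "left_module H L" and M: "left_module H M"
    and br: "br \<in> polylinear2 L L L" and act: "act \<in> polylinear2 L M M" and \<theta>: "\<theta> \<in> cochains 3 L M"
  shows "cocycle L br M act 3 \<theta> \<longleftrightarrow>
    (\<forall>x\<in>carrier L. \<forall>y\<in>carrier L. \<forall>z\<in>carrier L. \<forall>w\<in>carrier L.
      ins_right M act x M 3 (\<theta> [y, z, w])
        \<ominus>\<^bsub>htensor 4 M\<^esub> slots M [1, 0, 2, 3] (ins_right M act y M 3 (\<theta> [x, z, w]))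
        \<oplus>\<^bsub>htensor 4 M\<^esub> slots M [2, 0, 1, 3] (ins_right M act z M 3 (\<theta> [x, y, w]))
        \<ominus>\<^bsub>htensor 4 M\<^esub> slots M [3, 0, 1, 2] (ins_right M act w M 3 (\<theta> [x, y, z]))
        \<ominus>\<^bsub>htensor 4 M\<^esub> insert_at M 3 0 (\<lambda>e. \<theta> [e, z, w]) L 2 (br (x, y))
        \<oplus>\<^bsub>htensor 4 M\<^esub> slots M [0, 2, 1, 3] (insert_at M 3 0 (\<lambda>e. \<theta> [e, y, w]) L 2 (br (x, z)))
        \<ominus>\<^bsub>htensor 4 M\<^esub> slots M [0, 3, 1, 2] (insert_at M 3 0 (\<lambda>e. \<theta> [e, y, z]) L 2 (br (x, w)))
        \<ominus>\<^bsub>htensor 4 M\<^esub> slots M [1, 2, 0, 3] (insert_at M 3 0 (\<lambda>e. \<theta> [e, x, w]) L 2 (br (y, z)))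
        \<oplus>\<^bsub>htensor 4 M\<^esub> slots M [1, 3, 0, 2] (insert_at M 3 0 (\<lambda>e. \<theta> [e, x, z]) L 2 (br (y, w)))
        \<ominus>\<^bsub>htensor 4 M\<^esub> slots M [2, 3, 0, 1] (insert_at M 3 0 (\<lambda>e. \<theta> [e, x, y]) L 2 (br (z, w)))
      = \<zero>\<^bsub>htensor 4 M\<^esub>)"
proof -
  have "cocycle L br M act 3 \<theta> \<longleftrightarrow>
      (\<forall>xs\<in>arguments 4 L. coboundary L br M act 3 \<theta> xs = \<zero>\<^bsub>htensor 4 M\<^esub>)"
    using \<theta> by (simp add: cocycle_def)
  also have "\<dots> \<longleftrightarrow> (\<forall>x\<in>carrier L. \<forall>y\<in>carrier L. \<forall>z\<in>carrier L. \<forall>w\<in>carrier L.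
      coboundary L br M act 3 \<theta> [x, y, z, w] = \<zero>\<^bsub>htensor 4 M\<^esub>)" (is "?l = ?r")
  proof
    assume ?l
    then show ?r by (simp add: arguments_def)
  next
    assume ?r
    then show ?l by (blast elim: arguments_4E)
  qed
  finally show ?thesis
    by (simp only: coboundary_3[OF assms] cong: ball_cong)
qed

text \<open>Describes skeletal structures by conditions on the triple together with explicit
  formulas for the two fields that the triple omits, so the bijection and its inverse can be read
  off.\<close>

lemma skeletal_iff:
  fixes V :: "('h, 'l, 'm) two_term"
  shows "skeletal V \<longleftrightarrow>
    lie_pseudoalgebra (L0 V) (beta2_00 V) \<and>
    representation (L0 V) (beta2_00 V) (L1 V) (beta2_01 V) \<and>
    cocycle (L0 V) (beta2_00 V) (L1 V) (beta2_01 V) 3 (beta3 V) \<and>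
    beta1 V = (\<lambda>u\<in>carrier (L1 V). \<zero>\<^bsub>L0 V\<^esub>) \<and>
    beta2_10 V = opposite_action (L0 V) (L1 V) (beta2_01 V)"
proof -
  obtain L M b1 br act b10 \<theta> where
    V: "V = \<lparr>L0 = L, L1 = M, beta1 = b1, beta2_00 = br, beta2_01 = act, beta2_10 = b10, beta3 = \<theta>\<rparr>"
    by (cases V) blast
  \<comment> \<open>Both sides imply these conditions, and the vanishing and closure lemmas need
    them; the identities are therefore compared under \<open>base\<close> only.\<close>
  define base where "base \<longleftrightarrow> left_module H L \<and> left_module H M \<and>
    br \<in> polylinear2 L L L \<and> act \<in> polylinear2 L M M \<and> \<theta> \<in> cochains 3 L M \<and>
    b1 = (\<lambda>u\<in>carrier M. \<zero>\<^bsub>L\<^esub>) \<and> b10 = opposite_action L M act"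
  have fwd: base if "skeletal V"
  proof -
    \<comment> \<open>Members of \<open>linear_maps\<close> are extensional, so vanishing on
      \<open>carrier M\<close> determines \<open>b1\<close> as a function.\<close>
    have b1: "b1 = (\<lambda>u\<in>carrier M. \<zero>\<^bsub>L\<^esub>)"
    proof (rule extensionalityI)
      show "b1 \<in> extensional (carrier M)"
        using that by (auto simp: skeletal_def L_infinity_def V Let_def linear_maps_def PiE_def)
      show "b1 u = (\<lambda>u\<in>carrier M. \<zero>\<^bsub>L\<^esub>) u" if "u \<in> carrier M" for u
        using \<open>skeletal V\<close> that by (simp add: skeletal_def V)
    qed simp
    have b10: "b10 = opposite_action L M act"
    proof (rule extensionalityI)
      show "b10 \<in> extensional (carrier M \<times> carrier L)"
        using that by (auto simp: skeletal_def L_infinity_def V Let_def polylinear2_def PiE_def)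
      show "opposite_action L M act \<in> extensional (carrier M \<times> carrier L)"
        by (simp add: opposite_action_def)
      show "b10 p = opposite_action L M act p" if "p \<in> carrier M \<times> carrier L" for p
        using \<open>skeletal V\<close> that by (auto simp: skeletal_def L_infinity_def V Let_def opposite_action_def)
    qed
    show ?thesis
      using that b1 b10 unfolding base_def by (simp add: skeletal_def L_infinity_def V Let_def)
  qed
  have bwd: base if "lie_pseudoalgebra L br" "representation L br M act" "cocycle L br M act 3 \<theta>"
    "b1 = (\<lambda>u\<in>carrier M. \<zero>\<^bsub>L\<^esub>)" "b10 = opposite_action L M act"
    using that unfolding base_def by (simp add: lie_pseudoalgebra_def representation_def cocycle_def)
  have eq: "skeletal V \<longleftrightarrow> lie_pseudoalgebra L br \<and> representation L br M act \<and> cocycle L br M act 3 \<theta>"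
    if base
  proof -
    have L: "left_module H L" and M: "left_module H M" and br: "br \<in> polylinear2 L L L"
      and act: "act \<in> polylinear2 L M M" and \<theta>: "\<theta> \<in> cochains 3 L M"
      and b1: "b1 = (\<lambda>u\<in>carrier M. \<zero>\<^bsub>L\<^esub>)" and b10: "b10 = opposite_action L M act"
      using that by (auto simp: base_def)
    interpret L: left_module H L by fact
    interpret M: left_module H M by fact
    have n: "(2::nat) > 0" "(3::nat) > 0" by simp_all
    interpret L2: abelian_group "htensor 2 L" by (rule abelian_group_htensor[OF n(1) L])
    interpret M2: abelian_group "htensor 2 M" by (rule abelian_group_htensor[OF n(1) M])
    interpret L3: abelian_group "htensor 3 L" by (rule abelian_group_htensor[OF n(2) L])
    interpret M3: abelian_group "htensor 3 M" by (rule abelian_group_htensor[OF n(2) M])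
    note b10_polylinear = opposite_action_polylinear2[OF L M act]
    have b1_linear: "b1 \<in> linear_maps M L"
      by (auto simp: linear_maps_def b1 L.smult_zero M.smult_closed)
    have b1_zero: "b1 u = \<zero>\<^bsub>L\<^esub>" if "u \<in> carrier M" for u
      using that by (simp add: b1)
    have b1_all: "(\<forall>u\<in>carrier M. b1 u = \<zero>\<^bsub>L\<^esub>) \<longleftrightarrow> True"
      using b1_zero by simp
    have push0: "push k M L b1 w = \<zero>\<^bsub>htensor k L\<^esub>" if "k > 0" "w \<in> carrier (htensor k M)" for k w
      using push_zero[OF M L that] b1_zero by simp
    have br0: "br (x, \<zero>\<^bsub>L\<^esub>) = \<zero>\<^bsub>htensor 2 L\<^esub>" if "x \<in> carrier L" for x
      using add_hom_zero[OF L.M.abelian_group_axioms L2.abelian_group_axioms polylinear2_hom_right[OF br that]] .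
    have act0: "act (\<zero>\<^bsub>L\<^esub>, v) = \<zero>\<^bsub>htensor 2 M\<^esub>" if "v \<in> carrier M" for v
      using add_hom_zero[OF L.M.abelian_group_axioms M2.abelian_group_axioms polylinear2_hom_left[OF act that]] .
    have b10_0: "b10 (u, \<zero>\<^bsub>L\<^esub>) = \<zero>\<^bsub>htensor 2 M\<^esub>" if "u \<in> carrier M" for u
      using add_hom_zero[OF L.M.abelian_group_axioms M2.abelian_group_axioms
          polylinear2_hom_right[OF b10_polylinear that]] by (simp add: b10)
    have \<theta>0: "\<theta> [x, y, \<zero>\<^bsub>L\<^esub>] = \<zero>\<^bsub>htensor 3 M\<^esub>" if "x \<in> carrier L" "y \<in> carrier L" for x y
      using add_hom_zero[OF L.M.abelian_group_axioms M3.abelian_group_axioms cochains_3_hom_last[OF \<theta> that]] .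
    have slots_3: "slots A [1, 0, 2] w \<in> carrier (htensor 3 A)"
      if "left_module H A" "w \<in> carrier (htensor 3 A)" for A :: "('h, 'a) module" and w
      using that by (intro slots_closed) simp_all
    \<comment> \<open>Inducing along the zero map turns the right side into
      \<open>\<ominus> \<zero>\<close>; what remains is the Jacobi identity with all terms on one
      side.\<close>
    have lie: "ins_left L br L 2 (br (x, y)) z \<ominus>\<^bsub>htensor 3 L\<^esub> ins_right L br x L 2 (br (y, z))
          \<oplus>\<^bsub>htensor 3 L\<^esub> slots L [1, 0, 2] (ins_right L br y L 2 (br (x, z)))
        = \<ominus>\<^bsub>htensor 3 L\<^esub> push 3 M L b1 (\<theta> [x, y, z]) \<longleftrightarrow>
      ins_left L br L 2 (br (x, y)) z = ins_right L br x L 2 (br (y, z))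
        \<ominus>\<^bsub>htensor 3 L\<^esub> slots L [1, 0, 2] (ins_right L br y L 2 (br (x, z)))"
      if "x \<in> carrier L" "y \<in> carrier L" "z \<in> carrier L" for x y z
    proof -
      have "ins_left L br L 2 (br (x, y)) z \<in> carrier (htensor 3 L)"
        "ins_right L br x L 2 (br (y, z)) \<in> carrier (htensor 3 L)"
        "ins_right L br y L 2 (br (x, z)) \<in> carrier (htensor 3 L)"
        using that polylinear2_closed[OF br] by (auto intro!: ins_left_closed ins_right_closed L)
      then show ?thesis
        using that by (simp only: push0 n cochains_3_closed[OF \<theta>] L3.minus_zero
            L3.diff_plus_eq_zero_iff slots_3[OF L])
    qed
    have rep: "ins_left M act L 2 (br (x, y)) v \<ominus>\<^bsub>htensor 3 M\<^esub> ins_right M act x M 2 (act (y, v))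
          \<oplus>\<^bsub>htensor 3 M\<^esub> slots M [1, 0, 2] (ins_right M act y M 2 (act (x, v)))
        = \<ominus>\<^bsub>htensor 3 M\<^esub> \<theta> [x, y, b1 v] \<longleftrightarrow>
      ins_left M act L 2 (br (x, y)) v = ins_right M act x M 2 (act (y, v))
        \<ominus>\<^bsub>htensor 3 M\<^esub> slots M [1, 0, 2] (ins_right M act y M 2 (act (x, v)))"
      if "x \<in> carrier L" "y \<in> carrier L" "v \<in> carrier M" for x y v
    proof -
      have "ins_left M act L 2 (br (x, y)) v \<in> carrier (htensor 3 M)"
        "ins_right M act x M 2 (act (y, v)) \<in> carrier (htensor 3 M)"
        "ins_right M act y M 2 (act (x, v)) \<in> carrier (htensor 3 M)"
        using that polylinear2_closed[OF br] polylinear2_closed[OF act]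
        by (auto intro!: ins_left_closed ins_right_closed L M)
      then show ?thesis
        using that by (simp only: b1_zero \<theta>0 M3.minus_zero M3.diff_plus_eq_zero_iff slots_3[OF M])
    qed
    have i: "push 2 M L b1 (act (x, u)) = br (x, b1 u)" if "x \<in> carrier L" "u \<in> carrier M" for x u
      using that by (simp add: push0 polylinear2_closed[OF act] b1_zero br0)
    have ii: "act (b1 u, v) = b10 (u, b1 v)" if "u \<in> carrier M" "v \<in> carrier M" for u v
      using that by (simp add: b1_zero act0 b10_0)
    have b10_eq: "b10 (u, x) = \<ominus>\<^bsub>htensor 2 M\<^esub> slots M [1, 0] (act (x, u))"
      if "x \<in> carrier L" "u \<in> carrier M" for x u
      using that by (simp add: b10 opposite_action_def)
    have b10': "b10 \<in> polylinear2 M L M"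
      using b10_polylinear b10 by simp
    \<comment> \<open>Conditions contained in \<open>base\<close> or proved from it become true,
      \<open>cocycle_3_iff\<close> reproduces (v) literally, and skew-symmetry of the bracket occurs
      on both sides. \<open>ball_cong\<close> supplies the memberships required by
      \<open>lie\<close> and \<open>rep\<close>.\<close>
    show ?thesis
      unfolding skeletal_def L_infinity_def lie_pseudoalgebra_def representation_def V Let_def
        cocycle_3_iff[OF L M br act \<theta>] two_term.simps
      by (simp only: L M br act \<theta> b1_linear b10' i ii b10_eq b1_all lie rep simp_thms conj_assoc ball_triv
          cong: ball_cong)
  qed
  have "skeletal V \<longleftrightarrow> lie_pseudoalgebra L br \<and> representation L br M act \<and>
      cocycle L br M act 3 \<theta> \<and> b1 = (\<lambda>u\<in>carrier M. \<zero>\<^bsub>L\<^esub>) \<and> b10 = opposite_action L M act"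
    using fwd bwd eq base_def by blast
  then show ?thesis
    by (simp add: V)
qed

end

theorem proposition5p4:
  fixes K :: "('k, 'r) ring_scheme" and H :: "('k, 'h) hopf"
  assumes "cocommutative_hopf_algebra K H"
  shows "bij_betw
    (\<lambda>V :: ('h, 'l, 'm) two_term.
      ((L0 V, beta2_00 V), (L1 V, beta2_01 V), beta3 V))
    {V. hopf_signature.skeletal K H V}
    {((L, br), (M, act), \<theta>).
      hopf_signature.lie_pseudoalgebra K H L br \<and>
      hopf_signature.representation K H L br M act \<and>
      hopf_signature.cocycle K H L br M act 3 \<theta>}"
proof -
  interpret cocommutative_hopf_algebra K H
    by fact
  show ?thesis
  \<comment> \<open>The witness fills in the two omitted fields by the formulas of
    \<open>skeletal_iff\<close>, so that equivalence settles both round trips and both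
    inclusions.\<close>
  proof (rule bij_betw_byWitness[where f' = "\<lambda>((L, br), (M, act), \<theta>).
      \<lparr>L0 = L, L1 = M, beta1 = \<lambda>u\<in>carrier M. \<zero>\<^bsub>L\<^esub>, beta2_00 = br, beta2_01 = act,
        beta2_10 = opposite_action L M act, beta3 = \<theta>\<rparr>"])
  qed (auto simp: skeletal_iff)
qed

end
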